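(* Let $(\mathbb X,\mathcal X,\lambda)$ be a $\sigma$-finite measure space and let $\eta$ be a Poisson point process on $\mathbb X$ with intensity measure $\lambda$. Let $F$ be a bounded $\sigma(\eta)$-measurable random variable. Suppose that either (i) $D_xF\ge 0$ and $D^2_{x,y}F\le 0$ for every $x,y\in\mathbb X$, or (ii) $D_xF\le 0$ and $D^2_{x,y}F\ge 0$ for every $x,y\in\mathbb X$. Set $\alpha(F)=1$ if $2\|F\|_\infty>1$ and $\alpha(F)=2/(e+1)$ otherwise. Then $$\mathrm{Var}(F)\le 11\,(2\|F\|_\infty)^{\alpha(F)}\int_{\mathbb X}\Psi\big(\mathbb E[|D_xF|]\big)\,\lambda(dx),$$ where, for $a\ge 0$, $$\Psi(a)=\begin{cases}\dfrac{2}{1+\log(1/a)} & \text{if } a<1,\\[2mm] a & \text{if } a\ge 1,\end{cases}$$ with $\Psi(0)=0$.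
   Context: $(\Omega,\mathcal F,\mathbb P)$ is the underlying probability space, with expectation $\mathbb E$; $\|F\|_\infty$ is the $L^\infty(\mathbb P)$ norm. Point processes: $\mathbf N$ is the space of measures on $(\mathbb X,\mathcal X)$ that are countable sums of finite measures with values in $\{0,1,2,\dots\}$; $\mathcal N$ is the $\sigma$-algebra on $\mathbf N$ generated by the sets $\{\mu:\mu(B)=k\}$, $B\in\mathcal X$, $k\in\{0,1,2,\dots\}$. A Poisson point process (Poisson random measure) $\eta$ with intensity $\lambda$ is a random element of $(\mathbf N,\mathcal N)$ such that $\eta(B)$ is Poisson distributed with mean $\lambda(B)$ for every $B\in\mathcal X$ and $\eta(B_1),\dots,\eta(B_m)$ are independent for pairwise disjoint $B_1,\dots,B_m\in\mathcal X$. The process may be taken proper: $\eta=\sum_{n=1}^{\kappa}\delta_{X_n}$ for some $\mathbb X$-valued random variables $X_n$ and a $\{0,1,2,\dots\}\cup\{\infty\}$-valued random variable $\kappa$. A $\sigma(\eta)$-measurable random variable is written $F=F(\eta)$ for a measurable map $F:\mathbf N\to\mathbb R$. The add-one cost operator is $D_xF:=F(\eta+\delta_x)-F(\eta)$, and its iteration is $$D^2_{x,y}F:=D_xD_yF=F(\eta+\delta_x+\delta_y)-F(\eta+\delta_x)-F(\eta+\delta_y)+F(\eta).$$ *)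

theory Defs
  imports "HOL-Probability.Probability"
begin

section \<open>Point processes on a measurable space\<close>

text \<open>Measures on \<open>M\<close> that are countable sums of finite measures with values in
  \<open>{0, 1, 2, \<dots>}\<close>. Only the measurable space underlying \<open>M\<close> is used.\<close>

definition point_measures :: "'a measure \<Rightarrow> 'a measure set" where
  "point_measures M = {\<mu>. sets \<mu> = sets M \<and>
     (\<exists>\<nu> :: nat \<Rightarrow> 'a measure.
        (\<forall>n. sets (\<nu> n) = sets M \<and>
             (\<forall>B\<in>sets M. \<exists>k :: nat. emeasure (\<nu> n) B = of_nat k)) \<and>
        (\<forall>B\<in>sets M. emeasure \<mu> B = (\<Sum>n. emeasure (\<nu> n) B)))}"

definition point_measure_space :: "'a measure \<Rightarrow> 'a measure measure" where
  "point_measure_space M = sigma (point_measures M)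
     {{\<mu> \<in> point_measures M. emeasure \<mu> B = of_nat k} | B (k :: nat). B \<in> sets M}"

text \<open>A Poisson variable with infinite mean is almost surely infinite. The probability mass
  function is written out because \<open>poisson_pmf\<close> is restricted to positive means;
  here \<open>0 ^ 0 = 1\<close> makes a Poisson variable with mean \<open>0\<close> almost surely zero.\<close>

definition poisson_variable :: "'w measure \<Rightarrow> ennreal \<Rightarrow> ('w \<Rightarrow> ennreal) \<Rightarrow> bool" where
  "poisson_variable P m N \<longleftrightarrow> N \<in> borel_measurable P \<and>
     (if m = \<infinity> then AE \<omega> in P. N \<omega> = \<infinity>
      else \<forall>k :: nat. measure P {\<omega> \<in> space P. N \<omega> = of_nat k}
             = exp (- enn2real m) * enn2real m ^ k / fact k)"

definition poisson_process :: "'w measure \<Rightarrow> 'a measure \<Rightarrow> ('w \<Rightarrow> 'a measure) \<Rightarrow> bool" where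
  "poisson_process P M \<eta> \<longleftrightarrow>
     \<eta> \<in> measurable P (point_measure_space M) \<and>
     (\<forall>B\<in>sets M. poisson_variable P (emeasure M B) (\<lambda>\<omega>. emeasure (\<eta> \<omega>) B)) \<and>
     (\<forall>(m :: nat) B. (\<forall>i<m. B i \<in> sets M) \<longrightarrow> disjoint_family_on B {..<m} \<longrightarrow>
        prob_space.indep_vars P (\<lambda>_. borel) (\<lambda>i \<omega>. emeasure (\<eta> \<omega>) (B i)) {..<m})"

section \<open>Add-one cost operator\<close>

text \<open>\<open>return \<mu> x\<close> is the Dirac measure at \<open>x\<close> on the measurable space of \<open>\<mu>\<close>.\<close>

definition add_point :: "'a measure \<Rightarrow> 'a \<Rightarrow> 'a measure" where
  "add_point \<mu> x = measure_of (space \<mu>) (sets \<mu>) (\<lambda>B. emeasure \<mu> B + emeasure (return \<mu> x) B)"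

definition add_one_cost :: "'a \<Rightarrow> ('a measure \<Rightarrow> real) \<Rightarrow> 'a measure \<Rightarrow> real" where
  "add_one_cost x F \<mu> = F (add_point \<mu> x) - F \<mu>"

lemma sets_add_point: "sets (add_point \<mu> x) = sets \<mu>"
  by (simp add: add_point_def)

lemma emeasure_add_point:
  assumes "B \<in> sets \<mu>"
  shows "emeasure (add_point \<mu> x) B = emeasure \<mu> B + emeasure (return \<mu> x) B"
  unfolding add_point_def
proof (rule emeasure_measure_of_sigma)
  show "countably_additive (sets \<mu>) (\<lambda>B. emeasure \<mu> B + emeasure (return \<mu> x) B)"
  proof (rule countably_additiveI)
    fix A :: "nat \<Rightarrow> 'a set"
    assume A: "range A \<subseteq> sets \<mu>" "disjoint_family A"
    then show "(\<Sum>i. emeasure \<mu> (A i) + emeasure (return \<mu> x) (A i)) =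
        emeasure \<mu> (\<Union> (range A)) + emeasure (return \<mu> x) (\<Union> (range A))"
      by (subst suminf_add[symmetric]) (auto simp: suminf_emeasure simp del: emeasure_return)
  qed
qed (auto simp: assms positive_def sets.sigma_algebra_axioms)

section \<open>Quantities in the variance bound\<close>

text \<open>The \<open>L\<^sup>\<infinity>\<close> norm; meaningful for essentially bounded \<open>X\<close>.\<close>

definition Linf_norm :: "'w measure \<Rightarrow> ('w \<Rightarrow> real) \<Rightarrow> real" where
  "Linf_norm P X = real_of_ereal (esssup P (\<lambda>\<omega>. ereal \<bar>X \<omega>\<bar>))"

definition \<alpha>_exponent :: "'w measure \<Rightarrow> ('w \<Rightarrow> real) \<Rightarrow> real" where
  "\<alpha>_exponent P X = (if 2 * Linf_norm P X > 1 then 1 else 2 / (exp 1 + 1))"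

definition \<Psi> :: "real \<Rightarrow> real" where
  "\<Psi> a = (if a = 0 then 0 else if a < 1 then 2 / (1 + ln (1 / a)) else a)"

end

theory Submission
  imports Defs
begin

text \<open>
  Since \<open>a \<le> \<Psi> a\<close>, it suffices to bound the variance by \<open>4 \<parallel>F\<parallel>\<^sub>\<infinity> \<integral> E|D\<^sub>x F| \<lambda>(dx)\<close>, and by symmetry
  one may assume \<open>D\<^sub>x F \<ge> 0\<close> and \<open>D\<^sup>2 F \<le> 0\<close>. With \<open>S = {F > E F}\<close> one has \<open>E|F - E F| = 2 Cov(F, 1\<^sub>S)\<close>, so
  everything follows from \<open>Cov(F, 1\<^sub>S) \<le> \<integral> E|D\<^sub>x F| \<lambda>(dx)\<close> for arbitrary events \<open>S\<close>.

  By approximation, \<open>S\<close> may be taken to depend only on the vector \<open>N\<close> of counts in finitely many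
  disjoint cells \<open>A\<^sub>i\<close> of positive finite intensity. Put \<open>f k = E[F | N = k]\<close>. The Mecke equation gives
  \<open>f (k + e\<^sub>i) - f k = \<lambda>(A\<^sub>i)\<^sup>-\<^sup>1 \<integral>\<^sub>A\<^sub>i E[D\<^sub>x F | N = k] \<lambda>(dx)\<close>; hence \<open>f\<close> is increasing with decreasing
  increments, at every \<open>k\<close> and not just almost surely. Therefore \<open>f k \<le> f (k + l) \<le> f l + \<Sum>\<^sub>i k\<^sub>i (f (l + e\<^sub>i) - f l)\<close>.
  Averaging this over independent \<open>k\<close> and \<open>l\<close> distributed as \<open>N\<close>, restricted to \<open>k\<close> in the event and \<open>l\<close>
  outside of it, yields the covariance bound.
\<close>

section \<open>Point measures and their measurability\<close>

text \<open>Only the event is approximated, never \<open>F\<close>. A finite-dimensional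
  approximation of \<open>F\<close> would have to keep the signs of the first and second
  differences; conditioning on counts keeps them by itself. Since all cells have positive intensity,
  every count vector supported on them has positive probability, so the conditional mean is an
  elementary quotient and an almost sure inequality between functionals becomes an inequality at
  every \<open>k\<close>. The average closes up because the mean count of a cell is its intensity,
  which cancels the normalisation of the increments. What remains is a sum of integrals over
  disjoint cells, bounded by the integral over the whole space whatever the partition. This
  uniformity is what lets the approximation of the event pass to the limit. The Mecke equation is
  derived here from the Poisson recursion \<open>(n + 1) p(n + 1) = a p(n)\<close>. It has a second
  use: null sets of configurations stay null after a point is added, for almost every position.
  Without this, an almost sure bound on \<open>F\<close> would say nothing about \<open>F\<close> at
  a configuration with an added point.\<close>

lemma suminf_of_nat_ennreal:
  fixes f :: "nat \<Rightarrow> nat"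
  shows "(\<Sum>n. of_nat (f n) :: ennreal) \<in> range ennreal_of_enat"
proof -
  have "(\<Sum>n. of_nat (f n) :: ennreal) = (SUP n. \<Sum>i<n. of_nat (f i))"
    by (rule suminf_eq_SUP)
  also have "\<dots> = (SUP n. ennreal_of_enat (enat (\<Sum>i<n. f i)))"
    by simp
  also have "\<dots> = ennreal_of_enat (SUP n. enat (\<Sum>i<n. f i))"
    by (simp add: ennreal_of_enat_Sup image_image)
  finally show ?thesis by blast
qed

lemma sets_eq_of_point_measure: "\<mu> \<in> point_measures M \<Longrightarrow> sets \<mu> = sets M"
  by (simp add: point_measures_def)

lemma emeasure_point_measure_cases:
  assumes "\<mu> \<in> point_measures M"
  obtains "emeasure \<mu> B = \<infinity>" | k :: nat where "emeasure \<mu> B = of_nat k"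
proof (cases "B \<in> sets M")
  case True
  obtain \<nu> :: "nat \<Rightarrow> 'a measure" where
    \<nu>: "\<And>n. \<exists>k :: nat. emeasure (\<nu> n) B = of_nat k"
    and sum: "emeasure \<mu> B = (\<Sum>n. emeasure (\<nu> n) B)"
    using assms True unfolding point_measures_def by blast
  obtain f :: "nat \<Rightarrow> nat" where "\<And>n. emeasure (\<nu> n) B = of_nat (f n)"
    using \<nu> by metis
  with sum have "emeasure \<mu> B \<in> range ennreal_of_enat"
    using suminf_of_nat_ennreal[of f] by simp
  then obtain e where "emeasure \<mu> B = ennreal_of_enat e"
    by blast
  with that show thesis
    by (cases e) auto
next
  case False
  then have "emeasure \<mu> B = of_nat 0"
    using assms by (simp add: emeasure_notin_sets sets_eq_of_point_measure)
  with that show thesis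
    by blast
qed

lemma space_point_measure_space: "space (point_measure_space M) = point_measures M"
  unfolding point_measure_space_def by (rule space_measure_of) auto

lemma sets_point_measure_space:
  "sets (point_measure_space M) = sigma_sets (point_measures M)
     {{\<mu> \<in> point_measures M. emeasure \<mu> B = of_nat k} | B (k :: nat). B \<in> sets M}"
  unfolding point_measure_space_def by (rule sets_measure_of) auto

text \<open>The generators of the sigma-algebra on point measures only give the events that a count
  equals a finite \<open>k\<close>. The value \<infinity> is taken on the complement of their union,
  and \<open>f\<close> is constant on each of these countably many pieces.\<close>

lemma borel_measurable_of_nat_or_infinity:
  fixes f :: "'b \<Rightarrow> ennreal"
  assumes "\<And>x. x \<in> space N \<Longrightarrow> f x = \<infinity> \<or> (\<exists>k :: nat. f x = of_nat k)"
    and sets: "\<And>k :: nat. {x \<in> space N. f x = of_nat k} \<in> sets N"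
  shows "f \<in> borel_measurable N"
proof (rule measurable_piecewise_restrict[where C = "insert {x \<in> space N. f x = \<infinity>} (range (\<lambda>k :: nat. {x \<in> space N. f x = of_nat k}))"])
  have "{x \<in> space N. f x = \<infinity>} = space N - (\<Union>k :: nat. {x \<in> space N. f x = of_nat k})"
    using assms(1) by auto
  also have "\<dots> \<in> sets N"
    using sets by blast
  finally show "\<Omega> \<inter> space N \<in> sets N"
    if "\<Omega> \<in> insert {x \<in> space N. f x = \<infinity>} (range (\<lambda>k :: nat. {x \<in> space N. f x = of_nat k}))" for \<Omega>
    using that sets by (auto simp: Int_absorb2)
  show "f \<in> restrict_space N \<Omega> \<rightarrow>\<^sub>M borel"
    if "\<Omega> \<in> insert {x \<in> space N. f x = \<infinity>} (range (\<lambda>k :: nat. {x \<in> space N. f x = of_nat k}))" for \<Omega>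
  proof -
    have "\<exists>c. \<forall>x\<in>\<Omega>. f x = c"
      using that by blast
    then obtain c where "\<And>x. x \<in> \<Omega> \<Longrightarrow> f x = c"
      by blast
    then show ?thesis
      by (subst measurable_cong[where g = "\<lambda>_. c"]) (auto simp: space_restrict_space)
  qed
  show "space N \<subseteq> \<Union> (insert {x \<in> space N. f x = \<infinity>} (range (\<lambda>k :: nat. {x \<in> space N. f x = of_nat k})))"
    using assms(1) by auto
qed auto

lemma measurable_emeasure_point_measure [measurable]:
  assumes "B \<in> sets M"
  shows "(\<lambda>\<mu>. emeasure \<mu> B) \<in> borel_measurable (point_measure_space M)"
proof (rule borel_measurable_of_nat_or_infinity)
  fix \<mu> assume "\<mu> \<in> space (point_measure_space M)"
  then show "emeasure \<mu> B = \<infinity> \<or> (\<exists>k :: nat. emeasure \<mu> B = of_nat k)"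
    by (metis emeasure_point_measure_cases space_point_measure_space)
next
  fix k :: nat
  show "{\<mu> \<in> space (point_measure_space M). emeasure \<mu> B = of_nat k} \<in> sets (point_measure_space M)"
    unfolding space_point_measure_space sets_point_measure_space
    using assms by (intro sigma_sets.Basic) blast
qed

lemma emeasure_add_point_indicator:
  assumes "\<mu> \<in> point_measures M" "B \<in> sets M"
  shows "emeasure (add_point \<mu> x) B = emeasure \<mu> B + indicator B x"
  using assms by (simp add: emeasure_add_point sets_eq_of_point_measure)

lemma emeasure_return_eq_if: "emeasure (return N x) B = (if B \<in> sets N \<and> x \<in> B then 1 else 0)"
  by (cases "B \<in> sets N") (auto simp: emeasure_notin_sets)

lemma add_point_in_point_measures:
  assumes "\<mu> \<in> point_measures M"
  shows "add_point \<mu> x \<in> point_measures M"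
proof -
  obtain \<nu> :: "nat \<Rightarrow> 'a measure" where \<nu>: "\<And>n. sets (\<nu> n) = sets M"
      "\<And>n B. B \<in> sets M \<Longrightarrow> \<exists>k :: nat. emeasure (\<nu> n) B = of_nat k"
    and sum: "\<And>B. B \<in> sets M \<Longrightarrow> emeasure \<mu> B = (\<Sum>n. emeasure (\<nu> n) B)"
    using assms unfolding point_measures_def by blast
  \<comment> \<open>The Dirac measure has values 0 and 1, so it can be put in front of the sequence
    of finite measures that sum to \<open>\<mu>\<close>.\<close>
  define \<rho> where "\<rho> n = (case n of 0 \<Rightarrow> return M x | Suc k \<Rightarrow> \<nu> k)" for n
  have "sets (\<rho> n) = sets M" for n
    by (auto simp: \<rho>_def \<nu> split: nat.split)
  moreover have "\<exists>k :: nat. emeasure (\<rho> n) B = of_nat k" if "B \<in> sets M" for n B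
  proof (cases n)
    case 0
    then show ?thesis
      using that by (auto simp: \<rho>_def emeasure_return_eq_if intro: exI[of _ "0::nat"] exI[of _ "1::nat"])
  next
    case (Suc k)
    then show ?thesis
      using \<nu>(2)[OF that] by (simp add: \<rho>_def)
  qed
  moreover have "emeasure (add_point \<mu> x) B = (\<Sum>n. emeasure (\<rho> n) B)" if "B \<in> sets M" for B
  proof -
    have "(\<Sum>n. emeasure (\<rho> n) B) = (\<Sum>n. emeasure (\<nu> n) B) + emeasure (return M x) B"
      using suminf_offset[of "\<lambda>n. emeasure (\<rho> n) B" 1]
      by (simp add: \<rho>_def add.commute)
    then show ?thesis
      using assms that by (simp add: emeasure_add_point_indicator sum)
  qed
  ultimately show ?thesis
    unfolding point_measures_def using assms
    by (auto simp: sets_add_point sets_eq_of_point_measure intro!: exI[of _ \<rho>])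
qed

text \<open>Joint measurability in the point and the configuration is what Fubini and the Mecke
  equation use. On a generator it reduces to a count plus an indicator of the added point.\<close>

lemma measurable_add_point:
  "(\<lambda>(x, \<mu>). add_point \<mu> x) \<in> M \<Otimes>\<^sub>M point_measure_space M \<rightarrow>\<^sub>M point_measure_space M"
proof (rule measurable_sigma_sets[OF sets_point_measure_space])
  show "(\<lambda>(x, \<mu>). add_point \<mu> x) \<in> space (M \<Otimes>\<^sub>M point_measure_space M) \<rightarrow> point_measures M"
    by (auto simp: space_pair_measure space_point_measure_space add_point_in_point_measures)
next
  fix Y assume "Y \<in> {{\<mu> \<in> point_measures M. emeasure \<mu> B = of_nat k} | B (k :: nat). B \<in> sets M}"
  then obtain B and k :: nat where Y: "Y = {\<mu> \<in> point_measures M. emeasure \<mu> B = of_nat k}"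
    and [measurable]: "B \<in> sets M"
    by blast
  have "(\<lambda>(x, \<mu>). add_point \<mu> x) -` Y \<inter> space (M \<Otimes>\<^sub>M point_measure_space M) =
    (\<lambda>z. emeasure (snd z) B + indicator B (fst z)) -` {of_nat k} \<inter> space (M \<Otimes>\<^sub>M point_measure_space M)"
    by (auto simp: Y space_pair_measure space_point_measure_space add_point_in_point_measures
        emeasure_add_point_indicator)
  also have "\<dots> \<in> sets (M \<Otimes>\<^sub>M point_measure_space M)"
  proof (rule measurable_sets)
    have "(\<lambda>z. emeasure (snd z) B) \<in> borel_measurable (M \<Otimes>\<^sub>M point_measure_space M)"
      by (rule measurable_compose[OF measurable_snd measurable_emeasure_point_measure]) fact
    then show "(\<lambda>z. emeasure (snd z) B + indicator B (fst z)) \<in> borel_measurable (M \<Otimes>\<^sub>M point_measure_space M)"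
      by (intro borel_measurable_add measurable_compose[OF measurable_fst borel_measurable_indicator]) auto
  qed simp
  finally show "(\<lambda>(x, \<mu>). add_point \<mu> x) -` Y \<inter> space (M \<Otimes>\<^sub>M point_measure_space M)
      \<in> sets (M \<Otimes>\<^sub>M point_measure_space M)" .
qed auto

lemma measurable_add_point_compose [measurable (raw)]:
  assumes "f \<in> N \<rightarrow>\<^sub>M M" "g \<in> N \<rightarrow>\<^sub>M point_measure_space M"
  shows "(\<lambda>z. add_point (g z) (f z)) \<in> N \<rightarrow>\<^sub>M point_measure_space M"
  using measurable_compose[OF measurable_Pair[OF assms] measurable_add_point] by simp

section \<open>Finite-dimensional events\<close>

text \<open>Phrased through agreement of two configurations rather than as a preimage under a vector
  of counts: the sets carry no order and may overlap, and enlarging \<open>\<B>\<close> preserves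
  the property, which makes unions immediate.\<close>

definition determined_by :: "'a measure \<Rightarrow> 'a set set \<Rightarrow> 'a measure set \<Rightarrow> bool" where
  "determined_by M \<B> S \<longleftrightarrow> (\<forall>\<mu>\<in>point_measures M. \<forall>\<mu>'\<in>point_measures M.
     (\<forall>B\<in>\<B>. emeasure \<mu> B = emeasure \<mu>' B) \<longrightarrow> (\<mu> \<in> S \<longleftrightarrow> \<mu>' \<in> S))"

text \<open>Finite intensity makes the counts involved almost surely finite. These events form an
  algebra, which serves twice: as a pi-system for the Mecke equation and as a dense class for
  approximation.\<close>

definition finite_dim_events :: "'a measure \<Rightarrow> 'a measure set set" where
  "finite_dim_events M = {S \<in> sets (point_measure_space M).
     \<exists>\<B>. finite \<B> \<and> (\<forall>B\<in>\<B>. B \<in> sets M \<and> emeasure M B < \<infinity>) \<and> determined_by M \<B> S}"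

lemma determined_byI:
  assumes "\<And>\<mu> \<mu>'. \<mu> \<in> point_measures M \<Longrightarrow> \<mu>' \<in> point_measures M \<Longrightarrow>
       \<forall>B\<in>\<B>. emeasure \<mu> B = emeasure \<mu>' B \<Longrightarrow> \<mu> \<in> S \<longleftrightarrow> \<mu>' \<in> S"
  shows "determined_by M \<B> S"
  unfolding determined_by_def by (intro ballI impI) (rule assms)

lemma determined_byD:
  assumes "determined_by M \<B> S" "\<mu> \<in> point_measures M" "\<mu>' \<in> point_measures M"
    "\<forall>B\<in>\<B>. emeasure \<mu> B = emeasure \<mu>' B"
  shows "\<mu> \<in> S \<longleftrightarrow> \<mu>' \<in> S"
  using assms(1)[unfolded determined_by_def, rule_format, OF assms(2,3) bspec[OF assms(4)]] .

lemma finite_dim_eventsI: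
  assumes "S \<in> sets (point_measure_space M)" "finite \<B>"
    "\<And>B. B \<in> \<B> \<Longrightarrow> B \<in> sets M \<and> emeasure M B < \<infinity>" "determined_by M \<B> S"
  shows "S \<in> finite_dim_events M"
  unfolding finite_dim_events_def using assms
  by (intro CollectI conjI exI[of _ \<B>]) simp_all

lemma finite_dim_eventsE:
  assumes "S \<in> finite_dim_events M"
  obtains \<B> where "S \<in> sets (point_measure_space M)" "finite \<B>"
    "\<And>B. B \<in> \<B> \<Longrightarrow> B \<in> sets M \<and> emeasure M B < \<infinity>" "determined_by M \<B> S"
proof -
  from assms obtain \<B> where *: "S \<in> sets (point_measure_space M)" "finite \<B>"
    "\<forall>B\<in>\<B>. B \<in> sets M \<and> emeasure M B < \<infinity>" "determined_by M \<B> S"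
    unfolding finite_dim_events_def by (elim CollectE conjE exE)
  show thesis
    by (rule that[OF *(1,2) _ *(4)]) (use *(3) in simp)
qed

lemma sets_finite_dim_events: "S \<in> finite_dim_events M \<Longrightarrow> S \<in> sets (point_measure_space M)"
  by (simp add: finite_dim_events_def)

lemma finite_dim_events_subset: "S \<in> finite_dim_events M \<Longrightarrow> S \<subseteq> point_measures M"
  using sets.sets_into_space[OF sets_finite_dim_events] by (simp add: space_point_measure_space)

lemma point_measures_in_sets: "point_measures M \<in> sets (point_measure_space M)"
  by (metis sets.top space_point_measure_space)

lemma finite_dim_events_empty: "{} \<in> finite_dim_events M"
  by (rule finite_dim_eventsI[where \<B> = "{}"]) (simp_all add: determined_by_def)

lemma finite_dim_events_Diff:
  assumes "S \<in> finite_dim_events M"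
  shows "point_measures M - S \<in> finite_dim_events M"
  using assms
proof (rule finite_dim_eventsE)
  fix \<B> assume *: "S \<in> sets (point_measure_space M)" "finite \<B>"
    "\<And>B. B \<in> \<B> \<Longrightarrow> B \<in> sets M \<and> emeasure M B < \<infinity>" "determined_by M \<B> S"
  show "point_measures M - S \<in> finite_dim_events M"
  proof (rule finite_dim_eventsI[OF _ *(2,3)])
    show "point_measures M - S \<in> sets (point_measure_space M)"
      using *(1) point_measures_in_sets by (rule sets.Diff[rotated])
    show "determined_by M \<B> (point_measures M - S)"
    proof (rule determined_byI)
      fix \<mu> \<mu>' assume "\<mu> \<in> point_measures M" "\<mu>' \<in> point_measures M"
        "\<forall>B\<in>\<B>. emeasure \<mu> B = emeasure \<mu>' B"
      from determined_byD[OF *(4) this] \<open>\<mu> \<in> _\<close> \<open>\<mu>' \<in> _\<close>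
      show "\<mu> \<in> point_measures M - S \<longleftrightarrow> \<mu>' \<in> point_measures M - S"
        by simp
    qed
  qed
qed

lemma finite_dim_events_space: "point_measures M \<in> finite_dim_events M"
  using finite_dim_events_Diff[OF finite_dim_events_empty] by simp

lemma finite_dim_events_Un:
  assumes "S \<in> finite_dim_events M" "T \<in> finite_dim_events M"
  shows "S \<union> T \<in> finite_dim_events M"
  using assms(1)
proof (rule finite_dim_eventsE)
  fix \<B> assume S: "S \<in> sets (point_measure_space M)" "finite \<B>"
    "\<And>B. B \<in> \<B> \<Longrightarrow> B \<in> sets M \<and> emeasure M B < \<infinity>" "determined_by M \<B> S"
  show ?thesis
    using assms(2)
  proof (rule finite_dim_eventsE)
    fix \<C> assume T: "T \<in> sets (point_measure_space M)" "finite \<C>"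
      "\<And>B. B \<in> \<C> \<Longrightarrow> B \<in> sets M \<and> emeasure M B < \<infinity>" "determined_by M \<C> T"
    show ?thesis
    proof (rule finite_dim_eventsI[where \<B> = "\<B> \<union> \<C>"])
      show "determined_by M (\<B> \<union> \<C>) (S \<union> T)"
      proof (rule determined_byI)
        fix \<mu> \<mu>' assume *: "\<mu> \<in> point_measures M" "\<mu>' \<in> point_measures M"
          "\<forall>B\<in>\<B> \<union> \<C>. emeasure \<mu> B = emeasure \<mu>' B"
        have "\<mu> \<in> S \<longleftrightarrow> \<mu>' \<in> S"
          by (rule determined_byD[OF S(4) *(1,2)]) (rule ballI bspec[OF *(3)] UnI1)+
        moreover have "\<mu> \<in> T \<longleftrightarrow> \<mu>' \<in> T"
          by (rule determined_byD[OF T(4) *(1,2)]) (rule ballI bspec[OF *(3)] UnI2)+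
        ultimately show "\<mu> \<in> S \<union> T \<longleftrightarrow> \<mu>' \<in> S \<union> T"
          by simp
      qed
      show "B \<in> sets M \<and> emeasure M B < \<infinity>" if "B \<in> \<B> \<union> \<C>" for B
        using that S(3) T(3) by blast
    qed (use S T in auto)
  qed
qed

lemma Int_stable_finite_dim_events: "Int_stable (finite_dim_events M)"
proof (rule Int_stableI)
  fix S T assume *: "S \<in> finite_dim_events M" "T \<in> finite_dim_events M"
  then have "S \<subseteq> point_measures M" "T \<subseteq> point_measures M"
    by (simp_all add: finite_dim_events_subset)
  then have "S \<inter> T = point_measures M - ((point_measures M - S) \<union> (point_measures M - T))"
    by blast
  with * show "S \<inter> T \<in> finite_dim_events M"
    by (simp add: finite_dim_events_Diff finite_dim_events_Un)
qed

text \<open>The generators of the left side allow sets of infinite intensity. Sigma-finiteness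
  handles them: the count in \<open>B\<close> is the supremum of the counts in
  \<open>B \<inter> X n\<close> with \<open>X n\<close> increasing and of finite intensity.\<close>

lemma sets_point_measure_space_finite_dim:
  assumes "sigma_finite_measure M"
  shows "sets (point_measure_space M) = sigma_sets (point_measures M) (finite_dim_events M)"
    (is "_ = ?R")
proof
  interpret sigma_finite_measure M by fact
  have sub: "finite_dim_events M \<subseteq> Pow (point_measures M)"
    using finite_dim_events_subset by blast
  let ?N = "sigma (point_measures M) (finite_dim_events M)"
  have N: "space ?N = point_measures M" "sets ?N = ?R"
    using sub by auto
  obtain X :: "nat \<Rightarrow> 'a set" where X: "range X \<subseteq> sets M" "(\<Union>i. X i) = space M"
    "\<And>i. emeasure M (X i) \<noteq> \<infinity>" "incseq X"
    using sigma_finite_incseq by blast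
  have fin: "(\<lambda>\<mu>. emeasure \<mu> B) \<in> borel_measurable ?N"
    if B: "B \<in> sets M" "emeasure M B < \<infinity>" for B
  proof (rule borel_measurable_of_nat_or_infinity)
    show "emeasure \<mu> B = \<infinity> \<or> (\<exists>k :: nat. emeasure \<mu> B = of_nat k)" if "\<mu> \<in> space ?N" for \<mu>
      using that unfolding N by (metis emeasure_point_measure_cases)
    have "{\<mu> \<in> point_measures M. emeasure \<mu> B = of_nat k} \<in> finite_dim_events M" for k :: nat
    proof (rule finite_dim_eventsI[where \<B> = "{B}"])
      show "{\<mu> \<in> point_measures M. emeasure \<mu> B = of_nat k} \<in> sets (point_measure_space M)"
        unfolding sets_point_measure_space using B(1) by (intro sigma_sets.Basic) blast
      show "determined_by M {B} {\<mu> \<in> point_measures M. emeasure \<mu> B = of_nat k}"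
        by (rule determined_byI) (drule bspec[OF _ singletonI], simp only: mem_Collect_eq)
    qed (use B in auto)
    then show "{\<mu> \<in> space ?N. emeasure \<mu> B = of_nat k} \<in> sets ?N" for k :: nat
      unfolding N by (rule sigma_sets.Basic)
  qed
  have all: "(\<lambda>\<mu>. emeasure \<mu> B) \<in> borel_measurable ?N" if B: "B \<in> sets M" for B
  proof (subst measurable_cong)
    fix \<mu> assume "\<mu> \<in> space ?N"
    then have \<mu>: "sets \<mu> = sets M"
      unfolding N by (rule sets_eq_of_point_measure)
    have "B = (\<Union>n. B \<inter> X n)"
      using sets.sets_into_space[OF B] X(2) by blast
    moreover have "(SUP n. emeasure \<mu> (B \<inter> X n)) = emeasure \<mu> (\<Union>n. B \<inter> X n)"
      using X B \<mu> by (intro SUP_emeasure_incseq) (auto simp: incseq_def, blast)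
    ultimately show "emeasure \<mu> B = (SUP n. emeasure \<mu> (B \<inter> X n))"
      by simp
  next
    have "emeasure M (B \<inter> X n) < \<infinity>" for n
      using emeasure_mono[of "B \<inter> X n" "X n" M] X by (auto simp: top.not_eq_extremum intro: le_less_trans)
    then show "(\<lambda>\<mu>. SUP n. emeasure \<mu> (B \<inter> X n)) \<in> borel_measurable ?N"
      using X B by (intro borel_measurable_SUP fin) auto
  qed
  show "sets (point_measure_space M) \<subseteq> ?R"
    unfolding sets_point_measure_space
  proof (rule sigma_sets_mono, safe)
    fix B and k :: nat assume B: "B \<in> sets M"
    have "(\<lambda>\<mu>. emeasure \<mu> B) -` {of_nat k} \<inter> space ?N \<in> sets ?N"
      by (rule measurable_sets[OF all[OF B]]) simp
    also have "(\<lambda>\<mu>. emeasure \<mu> B) -` {of_nat k} \<inter> space ?N = {\<mu> \<in> point_measures M. emeasure \<mu> B = of_nat k}"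
      unfolding N by blast
    finally show "{\<mu> \<in> point_measures M. emeasure \<mu> B = of_nat k} \<in> ?R"
      unfolding N .
  qed
  show "?R \<subseteq> sets (point_measure_space M)"
    using sets.sigma_sets_subset[of "finite_dim_events M" "point_measure_space M"]
    using sets_finite_dim_events by (auto simp: space_point_measure_space)
qed

text \<open>The cells are the atoms of the finite algebra generated by \<open>\<B>\<close>. Atoms of
  intensity zero are collected in \<open>Z\<close>, because conditioning and division by the
  intensity require positive cells; the price is that members of \<open>\<B>\<close> are unions of
  cells only up to \<open>Z\<close>.\<close>

lemma finite_family_atoms:
  assumes fin: "finite \<B>" and \<B>: "\<And>B. B \<in> \<B> \<Longrightarrow> B \<in> sets M \<and> emeasure M B < \<infinity>"
  obtains m :: nat and A Z where
    "\<And>i. i < m \<Longrightarrow> A i \<in> sets M \<and> 0 < emeasure M (A i) \<and> emeasure M (A i) < \<infinity>"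
    "disjoint_family_on A {..<m}" "Z \<in> null_sets M" "\<And>i. i < m \<Longrightarrow> A i \<inter> Z = {}"
    "\<And>B. B \<in> \<B> \<Longrightarrow> \<exists>J\<subseteq>{..<m}. B \<union> Z = (\<Union>i\<in>J. A i) \<union> Z"
proof -
  \<comment> \<open>\<open>T\<close> records which members of \<open>\<B>\<close> contain the point.
    Intersecting with \<open>\<Union>\<B>\<close> discards the points in none of them, a region
    whose intensity may be infinite.\<close>
  define atom where "atom T = {x \<in> space M. \<forall>B\<in>\<B>. (x \<in> B) = (B \<in> T)} \<inter> \<Union>\<B>" for T
  have U: "\<Union>\<B> \<in> sets M"
    using \<B> by (intro sets.finite_Union fin subsetI) simp
  have "{x \<in> space M. (x \<in> B) = (B \<in> T)} \<in> sets M" if "B \<in> \<B>" for B T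
  proof -
    have "{x \<in> space M. (x \<in> B) = (B \<in> T)} = (if B \<in> T then B else space M - B)"
      using sets.sets_into_space[of B M] \<B>[OF that] by auto
    then show ?thesis
      using \<B>[OF that] by (auto intro: sets.compl_sets)
  qed
  then have atom_sets: "atom T \<in> sets M" for T
    unfolding atom_def by (intro sets.Int sets.sets_Collect_finite_All[OF _ fin] U)
  have disj: "atom T \<inter> atom T' = {}" if "T \<in> Pow \<B>" "T' \<in> Pow \<B>" "T \<noteq> T'" for T T'
    using that unfolding atom_def by blast
  have atom_mem: "x \<in> atom {B \<in> \<B>. x \<in> B}" if "B \<in> \<B>" "x \<in> B" for x B
  proof -
    have "B \<subseteq> space M"
      using \<B>[OF that(1)] sets.sets_into_space by blast
    then show ?thesis
      using that unfolding atom_def by blast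
  qed
  have U_fin: "emeasure M (\<Union>\<B>) < \<infinity>"
  proof -
    have "emeasure M (\<Union>B\<in>\<B>. B) \<le> (\<Sum>B\<in>\<B>. emeasure M B)"
      using fin \<B> by (intro emeasure_subadditive_finite) auto
    also have "\<dots> < \<infinity>"
      using fin \<B> by (auto simp: less_top[symmetric])
    finally show ?thesis by simp
  qed
  have atom_fin: "emeasure M (atom T) < \<infinity>" for T
    using emeasure_mono[of "atom T" "\<Union>\<B>" M] U U_fin by (auto simp: atom_def intro: le_less_trans)
  define \<P> where "\<P> = {T \<in> Pow \<B>. emeasure M (atom T) > 0}"
  define Z where "Z = (\<Union>T\<in>Pow \<B> - \<P>. atom T)"
  have "finite \<P>"
    using fin by (simp add: \<P>_def)
  then obtain h where h: "bij_betw h {..<card \<P>} \<P>"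
    using ex_bij_betw_nat_finite lessThan_atLeast0 by metis
  define A where "A i = atom (h i)" for i
  have hP: "h i \<in> \<P>" if "i < card \<P>" for i
    using h that by (auto simp: bij_betw_def)
  have Z_null: "Z \<in> null_sets M"
    unfolding Z_def using fin atom_sets
    by (intro null_sets_UN') (auto simp: \<P>_def null_sets_def countable_finite)
  show thesis
  proof (rule that[of "card \<P>" A Z])
    show "A i \<in> sets M \<and> 0 < emeasure M (A i) \<and> emeasure M (A i) < \<infinity>" if "i < card \<P>" for i
      using hP[OF that] atom_sets atom_fin by (auto simp: A_def \<P>_def)
    show "disjoint_family_on A {..<card \<P>}"
      unfolding disjoint_family_on_def A_def
    proof safe
      fix i j x assume ij: "i < card \<P>" "j < card \<P>" "i \<noteq> j" and x: "x \<in> atom (h i)" "x \<in> atom (h j)"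
      have "h i \<noteq> h j"
        using h ij by (auto simp: bij_betw_def inj_on_def)
      then show "x \<in> {}"
        using disj[of "h i" "h j"] hP ij x by (auto simp: \<P>_def)
    qed
    show "Z \<in> null_sets M" by fact
    show "A i \<inter> Z = {}" if "i < card \<P>" for i
    proof -
      have "atom (h i) \<inter> atom T = {}" if "T \<in> Pow \<B> - \<P>" for T
        using that hP[OF \<open>i < card \<P>\<close>] by (intro disj) (auto simp: \<P>_def)
      then show ?thesis
        unfolding A_def Z_def by blast
    qed
    show "\<exists>J\<subseteq>{..<card \<P>}. B \<union> Z = (\<Union>i\<in>J. A i) \<union> Z" if B: "B \<in> \<B>" for B
    proof (intro exI conjI)
      show "{i. i < card \<P> \<and> B \<in> h i} \<subseteq> {..<card \<P>}" by auto
      have "x \<in> (\<Union>i\<in>{i. i < card \<P> \<and> B \<in> h i}. A i) \<union> Z" if "x \<in> B" for x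
      proof -
        let ?T = "{B \<in> \<B>. x \<in> B}"
        have x: "x \<in> atom ?T"
          using atom_mem[OF B that] .
        show ?thesis
        proof (cases "?T \<in> \<P>")
          case True
          then obtain i where "i < card \<P>" "h i = ?T"
            using bij_betw_imp_surj_on[OF h] by (metis (no_types, lifting) imageE lessThan_iff)
          then show ?thesis
            using x B that by (auto simp: A_def intro!: bexI[of _ i])
        next
          case False
          then show ?thesis
            using x by (auto simp: Z_def)
        qed
      qed
      moreover have "A i \<subseteq> B" if "B \<in> h i" for i
        using that B by (auto simp: A_def atom_def)
      ultimately show "B \<union> Z = (\<Union>i\<in>{i. i < card \<P> \<and> B \<in> h i}. A i) \<union> Z"
        by blast
    qed
  qed
qed

section \<open>Counts in the cells of a finite partition\<close>

text \<open>A vector of counts is stored as a multiset of cell indices: adding the unit vector of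
  cell \<open>i\<close> is \<open>add_mset i\<close>, induction over vectors is multiset induction,
  and the type is countable.\<close>

definition counts :: "(nat \<Rightarrow> 'a set) \<Rightarrow> nat \<Rightarrow> 'a measure \<Rightarrow> nat multiset" where
  "counts A m \<mu> = (\<Sum>i<m. replicate_mset (nat \<lfloor>enn2real (emeasure \<mu> (A i))\<rfloor>) i)"

lemma count_counts:
  "count (counts A m \<mu>) i = (if i < m then nat \<lfloor>enn2real (emeasure \<mu> (A i))\<rfloor> else 0)"
  by (simp add: counts_def count_sum)

text \<open>Lets two measures on count vectors be compared on singletons, which is how the
  identities for the law of the counts are proved.\<close>

lemma countable_UNIV_multiset: "countable (UNIV :: 'b :: countable multiset set)"
proof -
  have "(UNIV :: 'b multiset set) = range mset"
    by (metis ex_mset surjI surj_def)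
  then show ?thesis
    using countable_image[OF countableI_type, of mset UNIV] by metis
qed

text \<open>\<open>Q\<close> plays the role of the law of the process. On this canonical space the
  process is the identity, so \<open>add_point\<close> acts on the sample points themselves.\<close>

locale poisson_law = Q: prob_space Q + sigma_finite_measure M
  for M :: "'a measure" and Q :: "'a measure measure" +
  assumes sets_Q [measurable_cong]: "sets Q = sets (point_measure_space M)"
    and poisson: "poisson_process Q M (\<lambda>\<mu>. \<mu>)"
begin

lemma space_Q: "space Q = point_measures M"
  using sets_eq_imp_space_eq[OF sets_Q] by (simp add: space_point_measure_space)

lemma measurable_emeasure_Q: "B \<in> sets M \<Longrightarrow> (\<lambda>\<mu>. emeasure \<mu> B) \<in> borel_measurable Q"
  using measurable_emeasure_point_measure measurable_cong_sets[OF sets_Q refl] by blast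

lemma prob_emeasure_eq:
  assumes "B \<in> sets M" "emeasure M B < \<infinity>"
  shows "Q.prob {\<mu> \<in> space Q. emeasure \<mu> B = of_nat k} = exp (- measure M B) * measure M B ^ k / fact k"
proof -
  have "poisson_variable Q (emeasure M B) (\<lambda>\<mu>. emeasure \<mu> B)"
    using poisson assms(1) by (simp add: poisson_process_def)
  then show ?thesis
    using assms(2) by (simp add: poisson_variable_def measure_def split: if_splits)
qed

text \<open>The Poisson weights of the finite values sum to \<open>exp (- a) * exp a = 1\<close>,
  leaving no mass for \<infinity>.\<close>

lemma AE_emeasure_finite:
  assumes B: "B \<in> sets M" "emeasure M B < \<infinity>"
  shows "AE \<mu> in Q. emeasure \<mu> B \<noteq> \<infinity>"
proof -
  let ?E = "\<lambda>k :: nat. {\<mu> \<in> space Q. emeasure \<mu> B = of_nat k}"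
  have E: "?E k \<in> sets Q" for k
    using measurable_emeasure_Q[OF B(1)] by measurable
  have "(\<lambda>k. Q.prob (?E k)) sums Q.prob (\<Union>k. ?E k)"
    using E by (intro Q.finite_measure_UNION) (auto simp: disjoint_family_on_def)
  moreover have "(\<lambda>k. Q.prob (?E k)) sums (exp (- measure M B) * exp (measure M B))"
    unfolding prob_emeasure_eq[OF B] using sums_mult[OF exp_converges[of "measure M B"], of "exp (- measure M B)"]
    by (simp add: field_simps)
  ultimately have "Q.prob (\<Union>k. ?E k) = 1"
    using sums_unique2 by (fastforce simp: exp_minus)
  then have "AE \<mu> in Q. \<mu> \<in> (\<Union>k. ?E k)"
    using E by (subst Q.AE_in_set_eq_1) auto
  then show ?thesis
    by eventually_elim auto
qed

lemma AE_emeasure_null: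
  assumes "B \<in> null_sets M"
  shows "AE \<mu> in Q. emeasure \<mu> B = 0"
proof -
  have B: "B \<in> sets M" "emeasure M B = 0"
    using assms by auto
  have "Q.prob {\<mu> \<in> space Q. emeasure \<mu> B = 0} = 1"
    using prob_emeasure_eq[of B 0] B by (simp add: measure_def)
  then have "AE \<mu> in Q. \<mu> \<in> {\<mu> \<in> space Q. emeasure \<mu> B = 0}"
    using measurable_emeasure_Q[OF B(1)] by (subst Q.AE_in_set_eq_1) auto
  then show ?thesis
    by eventually_elim auto
qed

lemma prob_emeasure_eq_prod:
  fixes A :: "nat \<Rightarrow> 'a set"
  assumes A: "\<And>i. i < m \<Longrightarrow> A i \<in> sets M" "\<And>i. i < m \<Longrightarrow> emeasure M (A i) < \<infinity>"
    and disj: "disjoint_family_on A {..<m}"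
  shows "Q.prob {\<mu> \<in> space Q. \<forall>i<m. emeasure \<mu> (A i) = of_nat (k i)} =
    (\<Prod>i<m. exp (- measure M (A i)) * measure M (A i) ^ k i / fact (k i))"
\<comment> \<open>The product rule for independent variables is stated for nonempty index
  sets.\<close>
proof (cases "m = 0")
  case True
  then show ?thesis
    by (simp add: Q.prob_space)
next
  case False
  have "Q.indep_vars (\<lambda>_. borel) (\<lambda>i \<mu>. emeasure \<mu> (A i)) {..<m}"
    using poisson A(1) disj unfolding poisson_process_def by blast
  then have "Q.prob (\<Inter>i\<in>{..<m}. (\<lambda>\<mu>. emeasure \<mu> (A i)) -` {of_nat (k i)} \<inter> space Q) =
      (\<Prod>i<m. Q.prob ((\<lambda>\<mu>. emeasure \<mu> (A i)) -` {of_nat (k i)} \<inter> space Q))"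
    using False by (intro Q.indep_varsD_finite) auto
  also have "(\<Inter>i\<in>{..<m}. (\<lambda>\<mu>. emeasure \<mu> (A i)) -` {of_nat (k i)} \<inter> space Q) =
      {\<mu> \<in> space Q. \<forall>i<m. emeasure \<mu> (A i) = of_nat (k i)}"
    using False by auto
  also have "(\<Prod>i<m. Q.prob ((\<lambda>\<mu>. emeasure \<mu> (A i)) -` {of_nat (k i)} \<inter> space Q)) =
      (\<Prod>i<m. exp (- measure M (A i)) * measure M (A i) ^ k i / fact (k i))"
  proof (rule prod.cong)
    fix i assume "i \<in> {..<m}"
    then have "Q.prob {\<mu> \<in> space Q. emeasure \<mu> (A i) = of_nat (k i)} =
        exp (- measure M (A i)) * measure M (A i) ^ k i / fact (k i)"
      by (intro prob_emeasure_eq A) auto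
    moreover have "{\<mu> \<in> space Q. emeasure \<mu> (A i) = of_nat (k i)} =
        (\<lambda>\<mu>. emeasure \<mu> (A i)) -` {of_nat (k i)} \<inter> space Q"
      by auto
    ultimately show "Q.prob ((\<lambda>\<mu>. emeasure \<mu> (A i)) -` {of_nat (k i)} \<inter> space Q) =
        exp (- measure M (A i)) * measure M (A i) ^ k i / fact (k i)"
      by simp
  qed simp
  finally show ?thesis .
qed

end

text \<open>Positive intensity gives every count vector supported on the cells positive probability.
  Disjointness from \<open>Z\<close> guarantees that a point added in a cell does not charge
  \<open>Z\<close>.\<close>

locale poisson_grid = poisson_law M Q
  for M :: "'a measure" and Q :: "'a measure measure" +
  fixes A :: "nat \<Rightarrow> 'a set" and m :: nat and Z :: "'a set"
  assumes cell: "i < m \<Longrightarrow> A i \<in> sets M \<and> 0 < emeasure M (A i) \<and> emeasure M (A i) < \<infinity>"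
    and disjoint_cells: "disjoint_family_on A {..<m}"
    and Z_null: "Z \<in> null_sets M"
    and cell_Z: "i < m \<Longrightarrow> A i \<inter> Z = {}"
begin

lemma cell_sets: "i < m \<Longrightarrow> A i \<in> sets M"
  using cell by blast

lemma cell_finite: "i < m \<Longrightarrow> emeasure M (A i) < top"
  using cell[of i] by simp

lemma cell_pos: "i < m \<Longrightarrow> measure M (A i) > 0"
  using cell[of i] by (simp add: measure_def enn2real_positive_iff)

text \<open>Outside of this set, \<^const>\<open>counts\<close> turns the value \<open>\<infinity>\<close> of a cell into \<open>0\<close>.\<close>

definition good :: "'a measure set" where
  "good = {\<mu> \<in> point_measures M. emeasure \<mu> Z = 0 \<and> (\<forall>i<m. emeasure \<mu> (A i) \<noteq> \<infinity>)}"

abbreviation N :: "'a measure \<Rightarrow> nat multiset" where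
  "N \<equiv> counts A m"

abbreviation \<nu> :: "nat multiset measure" where
  "\<nu> \<equiv> distr Q (count_space UNIV) N"

lemma AE_good: "AE \<mu> in Q. \<mu> \<in> good"
proof -
  have "AE \<mu> in Q. \<forall>i\<in>{..<m}. emeasure \<mu> (A i) \<noteq> \<infinity>"
    by (intro AE_finite_allI AE_emeasure_finite) (auto simp: cell_sets cell_finite)
  with AE_emeasure_null[OF Z_null] AE_space show ?thesis
    by eventually_elim (auto simp: good_def space_Q)
qed

lemma emeasure_good:
  assumes "\<mu> \<in> good" "i < m"
  shows "emeasure \<mu> (A i) = of_nat (count (N \<mu>) i)"
proof -
  have "\<mu> \<in> point_measures M" and "emeasure \<mu> (A i) \<noteq> \<infinity>"
    using assms by (auto simp: good_def)
  then obtain k :: nat where "emeasure \<mu> (A i) = of_nat k"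
    using emeasure_point_measure_cases by metis
  then show ?thesis
    using assms(2) by (simp add: count_counts)
qed

lemma counts_eq_iff:
  assumes "\<mu> \<in> good" "set_mset k \<subseteq> {..<m}"
  shows "N \<mu> = k \<longleftrightarrow> (\<forall>i<m. emeasure \<mu> (A i) = of_nat (count k i))"
proof -
  have "count (N \<mu>) i = 0" "count k i = 0" if "\<not> i < m" for i
    using that assms(2) by (auto simp: count_counts not_in_iff[symmetric])
  then show ?thesis
    using emeasure_good[OF assms(1)] by (auto simp: multiset_eq_iff) (metis)
qed

lemma set_counts: "set_mset (N \<mu>) \<subseteq> {..<m}"
proof
  fix i assume "i \<in># N \<mu>"
  then have "count (N \<mu>) i \<noteq> 0"
    by simp
  then show "i \<in> {..<m}"
    by (simp add: count_counts split: if_splits)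
qed

lemma measurable_counts: "N \<in> Q \<rightarrow>\<^sub>M count_space UNIV"
proof (subst measurable_count_space_eq_countable[OF countable_UNIV_multiset], intro conjI ballI)
  fix k :: "nat multiset"
  show "N -` {k} \<inter> space Q \<in> sets Q"
  proof (cases "set_mset k \<subseteq> {..<m}")
    case True
    have "count k i = 0" if "\<not> i < m" for i
      using that True by (auto simp: not_in_iff[symmetric])
    then have "N -` {k} \<inter> space Q = {\<mu> \<in> space Q. \<forall>i\<in>{..<m}. nat \<lfloor>enn2real (emeasure \<mu> (A i))\<rfloor> = count k i}"
      by (auto simp: multiset_eq_iff count_counts)
    also have "\<dots> \<in> sets Q"
    proof (rule sets.sets_Collect_finite_All)
      fix i assume "i \<in> {..<m}"
      then have [measurable]: "(\<lambda>\<mu>. emeasure \<mu> (A i)) \<in> borel_measurable Q"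
        by (intro measurable_emeasure_Q cell_sets) simp
      show "{\<mu> \<in> space Q. nat \<lfloor>enn2real (emeasure \<mu> (A i))\<rfloor> = count k i} \<in> sets Q"
        by measurable
    qed simp
    finally show ?thesis .
  next
    case False
    then have "N -` {k} \<inter> space Q = {}"
      using set_counts by auto
    then show ?thesis
      by simp
  qed
qed simp

lemma prob_space_\<nu>: "prob_space \<nu>"
  by (rule Q.prob_space_distr[OF measurable_counts])

lemma measure_\<nu>: "measure \<nu> K = Q.prob (N -` K \<inter> space Q)"
  by (rule measure_distr[OF measurable_counts]) simp

lemma AE_\<nu>: "AE k in \<nu>. set_mset k \<subseteq> {..<m}"
  by (subst AE_distr_iff[OF measurable_counts]) (auto simp: set_counts)

lemma measure_\<nu>_singleton:
  "measure \<nu> {k} = (if set_mset k \<subseteq> {..<m}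
     then \<Prod>i<m. exp (- measure M (A i)) * measure M (A i) ^ count k i / fact (count k i) else 0)"
proof (cases "set_mset k \<subseteq> {..<m}")
  case True
  \<comment> \<open>The two events can differ only at configurations with an infinite count in some
    cell, which are negligible.\<close>
  have eq: "AE \<mu> in Q. \<mu> \<in> N -` {k} \<inter> space Q \<longleftrightarrow>
      \<mu> \<in> {\<mu> \<in> space Q. \<forall>i<m. emeasure \<mu> (A i) = of_nat (count k i)}"
    using AE_good by eventually_elim (auto simp: counts_eq_iff[OF _ True])
  have "{\<mu> \<in> space Q. \<forall>i\<in>{..<m}. emeasure \<mu> (A i) = of_nat (count k i)} \<in> sets Q"
  proof (rule sets.sets_Collect_finite_All)
    fix i assume "i \<in> {..<m}"
    then have [measurable]: "(\<lambda>\<mu>. emeasure \<mu> (A i)) \<in> borel_measurable Q"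
      by (intro measurable_emeasure_Q cell_sets) simp
    show "{\<mu> \<in> space Q. emeasure \<mu> (A i) = of_nat (count k i)} \<in> sets Q"
      by measurable
  qed simp
  then have ev: "{\<mu> \<in> space Q. \<forall>i<m. emeasure \<mu> (A i) = of_nat (count k i)} \<in> sets Q"
    unfolding Ball_def lessThan_iff .
  have "Q.prob (N -` {k} \<inter> space Q) =
      Q.prob {\<mu> \<in> space Q. \<forall>i<m. emeasure \<mu> (A i) = of_nat (count k i)}"
    by (rule Q.finite_measure_eq_AE[OF eq _ ev]) (rule measurable_sets[OF measurable_counts], simp)
  then show ?thesis
    using True by (simp add: measure_\<nu> prob_emeasure_eq_prod cell_sets cell_finite disjoint_cells)
next
  case False
  then have "N -` {k} \<inter> space Q = {}"
    using set_counts by auto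
  with False show ?thesis
    by (simp add: measure_\<nu>)
qed

lemma measure_\<nu>_pos: "set_mset k \<subseteq> {..<m} \<Longrightarrow> 0 < measure \<nu> {k}"
  unfolding measure_\<nu>_singleton by (auto intro!: prod_pos simp: cell_pos)

text \<open>The Poisson recursion \<open>(n + 1) p(n + 1) = a p(n)\<close> in the factor of cell
  \<open>i\<close>; the other factors are unchanged. If \<open>k\<close> contains a foreign index,
  both sides vanish.\<close>

lemma measure_\<nu>_add_mset:
  assumes i: "i < m"
  shows "real (Suc (count k i)) * measure \<nu> {add_mset i k} = measure M (A i) * measure \<nu> {k}"
proof (cases "set_mset k \<subseteq> {..<m}")
  case True
  define p where "p j n = exp (- measure M (A j)) * measure M (A j) ^ n / fact n" for j n
  have p: "real (Suc n) * p i (Suc n) = measure M (A i) * p i n" for n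
    by (simp add: p_def field_simps del: of_nat_Suc)
  have "measure \<nu> {add_mset i k} = (\<Prod>j<m. p j (count (add_mset i k) j))"
    using i True by (simp add: measure_\<nu>_singleton p_def)
  also have "\<dots> = p i (Suc (count k i)) * (\<Prod>j\<in>{..<m} - {i}. p j (count k j))"
    using i by (subst prod.remove[of _ i]) auto
  finally have "real (Suc (count k i)) * measure \<nu> {add_mset i k} =
      measure M (A i) * (p i (count k i) * (\<Prod>j\<in>{..<m} - {i}. p j (count k j)))"
    using p[of "count k i"] by simp
  also have "p i (count k i) * (\<Prod>j\<in>{..<m} - {i}. p j (count k j)) = measure \<nu> {k}"
    using i True by (subst prod.remove[of _ i, symmetric]) (auto simp: measure_\<nu>_singleton p_def)
  finally show ?thesis .
next
  case False
  then show ?thesis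
    by (simp add: measure_\<nu>_singleton)
qed

end

section \<open>The Mecke equation\<close>

context poisson_grid
begin

text \<open>The Mecke equation for the counts: weighting \<open>\<nu>\<close> by the count of cell
  \<open>i\<close> gives, up to the intensity, the image of \<open>\<nu>\<close> under adding a
  point to that cell. On a singleton this is the Poisson recursion; a vector without
  \<open>i\<close> has weight zero on the left and no preimage on the right.\<close>

lemma nn_integral_count_\<nu>:
  assumes i: "i < m"
  shows "(\<integral>\<^sup>+k. of_nat (count k i) * indicator K k \<partial>\<nu>) = emeasure M (A i) * emeasure \<nu> (add_mset i -` K)"
proof -
  interpret \<nu>: prob_space \<nu>
    by (rule prob_space_\<nu>)
  let ?L = "density \<nu> (\<lambda>k. of_nat (count k i))"
  let ?R = "scale_measure (emeasure M (A i)) (distr \<nu> (count_space UNIV) (add_mset i))"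
  have "?L = ?R"
  proof (rule measure_eqI_countable[where A = UNIV])
    fix a :: "nat multiset"
    have L: "emeasure ?L {a} = of_nat (count a i) * emeasure \<nu> {a}"
      by (simp add: emeasure_density)
    have R: "emeasure ?R {a} = emeasure M (A i) * emeasure \<nu> (add_mset i -` {a})"
      by (simp add: emeasure_scale_measure emeasure_distr)
    show "emeasure ?L {a} = emeasure ?R {a}"
    proof (cases "i \<in># a")
      case True
      then obtain b where b: "a = add_mset i b"
        by (metis mset_add)
      then have "add_mset i -` {a} = {b}"
        by auto
      moreover have "of_nat (count a i) * emeasure \<nu> {a} =
          emeasure M (A i) * emeasure \<nu> {b}"
      proof -
        have "of_nat (count a i) * emeasure \<nu> {a} = ennreal (real (Suc (count b i)) * measure \<nu> {a})"
          unfolding \<nu>.emeasure_eq_measure b ennreal_of_nat_eq_real_of_nat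
          by (subst ennreal_mult) simp_all
        also have "\<dots> = ennreal (measure M (A i) * measure \<nu> {b})"
          unfolding b measure_\<nu>_add_mset[OF i] ..
        finally show ?thesis
          using cell_finite[OF i] by (simp add: ennreal_mult \<nu>.emeasure_eq_measure emeasure_eq_ennreal_measure)
      qed
      ultimately show ?thesis
        unfolding L R by simp
    next
      case False
      then have "add_mset i -` {a} = {}"
        by auto
      with False show ?thesis
        unfolding L R by (simp add: not_in_iff)
    qed
  qed (simp_all add: countable_UNIV_multiset)
  then have "emeasure ?L K = emeasure ?R K"
    by simp
  then show ?thesis
    by (simp add: emeasure_density emeasure_scale_measure emeasure_distr)
qed

lemma null_sets_good:
  assumes "\<mu> \<in> good"
  shows "sets \<mu> = sets M" "Z \<in> null_sets \<mu>"
  using assms Z_null by (auto simp: good_def sets_eq_of_point_measure intro!: null_setsI)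

text \<open>Translates \<open>add_point\<close> into \<open>add_mset\<close> on the level of counts.
  As the cells are disjoint from one another and from \<open>Z\<close>, the new point changes one
  count only.\<close>

lemma add_point_good:
  assumes \<mu>: "\<mu> \<in> good" and i: "i < m" and x: "x \<in> A i"
  shows "add_point \<mu> x \<in> good" and "N (add_point \<mu> x) = add_mset i (N \<mu>)"
proof -
  have pm: "\<mu> \<in> point_measures M" "emeasure \<mu> Z = 0"
    using \<mu> by (auto simp: good_def)
  have "x \<notin> Z"
    using cell_Z[OF i] x by blast
  then have "emeasure (add_point \<mu> x) Z = 0"
    using Z_null pm by (simp add: emeasure_add_point_indicator[of \<mu> M] null_sets_def)
  moreover have eq: "emeasure (add_point \<mu> x) (A j) = of_nat (count (add_mset i (N \<mu>)) j)" if "j < m" for j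
  proof -
    have "x \<in> A j \<longleftrightarrow> j = i"
      using disjoint_cells that i x unfolding disjoint_family_on_def by blast
    then show ?thesis
      using that pm(1) by (simp add: emeasure_add_point_indicator[of \<mu> M] cell_sets emeasure_good[OF \<mu>] indicator_def)
  qed
  ultimately show good: "add_point \<mu> x \<in> good"
    using pm(1) by (auto simp: good_def add_point_in_point_measures)
  show "N (add_point \<mu> x) = add_mset i (N \<mu>)"
    using eq i set_counts by (subst counts_eq_iff[OF good]) auto
qed

text \<open>Up to \<open>Z\<close>, which good configurations do not charge, \<open>C\<close> is a
  disjoint union of cells, so its count is a sum of cell counts. Each summand is settled by
  \<open>nn_integral_count_\<nu>\<close>, and the intensity factor is rewritten as an integral over
  the cell, on which the probability of the shifted event is constant.\<close>

lemma mecke_grid: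
  assumes C: "C \<in> sets M" and J: "J \<subseteq> {..<m}" "C \<union> Z = (\<Union>i\<in>J. A i) \<union> Z"
    and S: "S \<in> sets Q" "\<And>\<mu>. \<mu> \<in> good \<Longrightarrow> \<mu> \<in> S \<longleftrightarrow> N \<mu> \<in> K"
  shows "(\<integral>\<^sup>+\<mu>. emeasure \<mu> C * indicator S \<mu> \<partial>Q) =
    (\<integral>\<^sup>+x. indicator C x * emeasure Q {\<mu> \<in> space Q. add_point \<mu> x \<in> S} \<partial>M)"
proof -
  have finJ: "finite J"
    using J(1) finite_subset by blast
  have cJ: "A i \<in> sets M" "i < m" if "i \<in> J" for i
    using that J(1) cell_sets by auto
  have disjJ: "disjoint_family_on A J"
    using disjoint_cells J(1) by (rule disjoint_family_on_mono[rotated])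
  have "(\<integral>\<^sup>+\<mu>. emeasure \<mu> C * indicator S \<mu> \<partial>Q) =
      (\<integral>\<^sup>+\<mu>. (\<Sum>i\<in>J. of_nat (count (N \<mu>) i) * indicator K (N \<mu>)) \<partial>Q)"
  proof (rule nn_integral_cong_AE, use AE_good in eventually_elim)
    fix \<mu> assume \<mu>: "\<mu> \<in> good"
    then have pm: "sets \<mu> = sets M" "Z \<in> null_sets \<mu>"
      by (simp_all add: null_sets_good)
    have "emeasure \<mu> C = emeasure \<mu> (C \<union> Z)"
      using C pm by (simp add: emeasure_Un_null_set)
    also have "\<dots> = emeasure \<mu> (\<Union>i\<in>J. A i)"
      unfolding J(2) using pm cJ finJ by (intro emeasure_Un_null_set) auto
    also have "\<dots> = (\<Sum>i\<in>J. emeasure \<mu> (A i))"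
      using pm cJ finJ disjJ by (intro sum_emeasure[symmetric]) auto
    also have "\<dots> = (\<Sum>i\<in>J. of_nat (count (N \<mu>) i))"
      by (intro sum.cong refl emeasure_good[OF \<mu>] cJ)
    finally show "emeasure \<mu> C * indicator S \<mu> = (\<Sum>i\<in>J. of_nat (count (N \<mu>) i) * indicator K (N \<mu>))"
      using S(2)[OF \<mu>] by (simp add: sum_distrib_right indicator_def)
  qed
  also have "\<dots> = (\<Sum>i\<in>J. \<integral>\<^sup>+\<mu>. of_nat (count (N \<mu>) i) * indicator K (N \<mu>) \<partial>Q)"
    using measurable_compose[OF measurable_counts, of _ borel] by (intro nn_integral_sum) simp
  also have "\<dots> = (\<Sum>i\<in>J. \<integral>\<^sup>+k. of_nat (count k i) * indicator K k \<partial>\<nu>)"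
    by (intro sum.cong refl nn_integral_distr[symmetric] measurable_counts) simp
  also have "\<dots> = (\<Sum>i\<in>J. emeasure M (A i) * emeasure \<nu> (add_mset i -` K))"
    by (intro sum.cong refl nn_integral_count_\<nu> cJ)
  also have "\<dots> = (\<Sum>i\<in>J. \<integral>\<^sup>+x. emeasure \<nu> (add_mset i -` K) * indicator (A i) x \<partial>M)"
    by (intro sum.cong refl) (simp add: nn_integral_cmult_indicator[OF cJ(1)] mult.commute[of "emeasure M _"])
  also have "\<dots> = (\<integral>\<^sup>+x. (\<Sum>i\<in>J. emeasure \<nu> (add_mset i -` K) * indicator (A i) x) \<partial>M)"
    using cJ by (intro nn_integral_sum[symmetric]) simp
  also have "\<dots> = (\<integral>\<^sup>+x. indicator C x * emeasure Q {\<mu> \<in> space Q. add_point \<mu> x \<in> S} \<partial>M)"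
  proof (rule nn_integral_cong_AE, use AE_not_in[OF Z_null] AE_space in eventually_elim)
    fix x assume x: "x \<notin> Z" "x \<in> space M"
    show "(\<Sum>i\<in>J. emeasure \<nu> (add_mset i -` K) * indicator (A i) x) =
        indicator C x * emeasure Q {\<mu> \<in> space Q. add_point \<mu> x \<in> S}"
    proof (cases "x \<in> C")
      case True
      then obtain i where i: "i \<in> J" "x \<in> A i"
        using x J(2) by blast
      have "(\<Sum>j\<in>J. emeasure \<nu> (add_mset j -` K) * indicator (A j) x) =
          (\<Sum>j\<in>J. if j = i then emeasure \<nu> (add_mset i -` K) else 0)"
      proof (intro sum.cong refl)
        fix j assume "j \<in> J"
        then have "x \<in> A j \<longleftrightarrow> j = i"
          using disjJ i unfolding disjoint_family_on_def by blast
        then show "emeasure \<nu> (add_mset j -` K) * indicator (A j) x =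
            (if j = i then emeasure \<nu> (add_mset i -` K) else 0)"
          by (auto simp: indicator_def)
      qed
      also have "\<dots> = emeasure Q (N -` (add_mset i -` K) \<inter> space Q)"
        using finJ i by (simp add: emeasure_distr[OF measurable_counts])
      also have "\<dots> = emeasure Q {\<mu> \<in> space Q. add_point \<mu> x \<in> S}"
      proof (rule emeasure_eq_AE)
        show "AE \<mu> in Q. \<mu> \<in> N -` (add_mset i -` K) \<inter> space Q \<longleftrightarrow> \<mu> \<in> {\<mu> \<in> space Q. add_point \<mu> x \<in> S}"
          using AE_good by eventually_elim (auto simp: S(2) add_point_good[OF _ cJ(2) i(2)] i(1))
        show "N -` (add_mset i -` K) \<inter> space Q \<in> sets Q"
          by (rule measurable_sets[OF measurable_counts]) simp
        have "(\<lambda>\<mu>. add_point \<mu> x) \<in> Q \<rightarrow>\<^sub>M Q"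
          using x(2) by measurable
        from measurable_sets[OF this S(1)] show "{\<mu> \<in> space Q. add_point \<mu> x \<in> S} \<in> sets Q"
          by (simp add: vimage_def Int_def conj_commute)
      qed
      finally show ?thesis
        using True by simp
    next
      case False
      then have "indicator (A i) x = (0 :: ennreal)" if "i \<in> J" for i
        using that x J(2) by (auto simp: indicator_def)
      with False show ?thesis
        by simp
    qed
  qed
  finally show ?thesis .
qed

end

section \<open>The Mecke equation as an identity of measures\<close>

context poisson_law
begin

text \<open>\<open>C\<close> joins the family that determines \<open>S\<close> before atoms are
  formed, so that a single partition resolves both the event and the set whose points are
  counted.\<close>

lemma finite_dim_grid:
  assumes S: "S \<in> finite_dim_events M" and C: "C \<in> sets M" "emeasure M C < \<infinity>"
  obtains A m Z J K where "poisson_grid M Q A m Z" "J \<subseteq> {..<m}" "C \<union> Z = (\<Union>i\<in>J. A i) \<union> Z"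
    "\<And>\<mu>. \<mu> \<in> poisson_grid.good M A m Z \<Longrightarrow> \<mu> \<in> S \<longleftrightarrow> counts A m \<mu> \<in> K"
proof -
  obtain \<B> where \<B>: "finite \<B>" "\<And>B. B \<in> \<B> \<Longrightarrow> B \<in> sets M \<and> emeasure M B < \<infinity>"
    and det: "determined_by M \<B> S"
    using S unfolding finite_dim_events_def by blast
  obtain m :: nat and A Z where
    cell: "\<And>i. i < m \<Longrightarrow> A i \<in> sets M \<and> 0 < emeasure M (A i) \<and> emeasure M (A i) < \<infinity>"
    and disj: "disjoint_family_on A {..<m}" and Z: "Z \<in> null_sets M" "\<And>i. i < m \<Longrightarrow> A i \<inter> Z = {}"
    and cover: "\<And>B. B \<in> insert C \<B> \<Longrightarrow> \<exists>J\<subseteq>{..<m}. B \<union> Z = (\<Union>i\<in>J. A i) \<union> Z"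
    using finite_family_atoms[of "insert C \<B>" M] \<B> C by (smt (verit) finite_insert insert_iff)
  interpret poisson_grid M Q A m Z
    by unfold_locales (use cell disj Z in blast)+
  obtain J where J: "J \<subseteq> {..<m}" "C \<union> Z = (\<Union>i\<in>J. A i) \<union> Z"
    using cover[of C] by blast
  have same: "emeasure \<mu> B = emeasure \<mu>' B"
    if "\<mu> \<in> good" "\<mu>' \<in> good" "N \<mu> = N \<mu>'" "B \<in> \<B>" for \<mu> \<mu>' B
  proof -
    obtain I where I: "I \<subseteq> {..<m}" "B \<union> Z = (\<Union>i\<in>I. A i) \<union> Z"
      using cover[of B] \<open>B \<in> \<B>\<close> by blast
    have *: "emeasure \<rho> B = (\<Sum>i\<in>I. of_nat (count (N \<rho>) i))" if \<rho>: "\<rho> \<in> good" for \<rho>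
    proof -
      have pm: "sets \<rho> = sets M" "Z \<in> null_sets \<rho>"
        using \<rho> by (simp_all add: null_sets_good)
      have "emeasure \<rho> B = emeasure \<rho> (B \<union> Z)"
        using \<B> \<open>B \<in> \<B>\<close> pm by (simp add: emeasure_Un_null_set)
      also have "\<dots> = emeasure \<rho> (\<Union>i\<in>I. A i)"
        unfolding I(2) using pm I(1) cell finite_subset[OF I(1)] by (intro emeasure_Un_null_set) auto
      also have "\<dots> = (\<Sum>i\<in>I. emeasure \<rho> (A i))"
        using pm cell I(1) finite_subset[OF I(1)] disjoint_family_on_mono[OF I(1) disj]
        by (intro sum_emeasure[symmetric]) auto
      also have "\<dots> = (\<Sum>i\<in>I. of_nat (count (N \<rho>) i))"
        using I(1) by (intro sum.cong refl emeasure_good[OF \<rho>]) auto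
      finally show ?thesis .
    qed
    show ?thesis
      using that by (simp add: *)
  qed
  show thesis
  proof (rule that[OF _ J])
    show "poisson_grid M Q A m Z" ..
    \<comment> \<open>\<open>K\<close> is the set of count vectors of good members of
      \<open>S\<close>. It cannot admit good configurations outside \<open>S\<close>, because equal
      counts force equal values on every set of \<open>\<B>\<close>.\<close>
    show "\<mu> \<in> S \<longleftrightarrow> N \<mu> \<in> N ` (S \<inter> good)" if \<mu>: "\<mu> \<in> good" for \<mu>
    proof
      assume "N \<mu> \<in> N ` (S \<inter> good)"
      then obtain \<mu>' where \<mu>': "\<mu>' \<in> S" "\<mu>' \<in> good" "N \<mu> = N \<mu>'"
        by blast
      have "\<mu> \<in> S \<longleftrightarrow> \<mu>' \<in> S"
      proof (rule determined_byD[OF det])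
        show "\<forall>B\<in>\<B>. emeasure \<mu> B = emeasure \<mu>' B"
          using same[OF \<mu> \<mu>'(2,3)] by blast
      qed (use \<mu> \<mu>' in \<open>auto simp: good_def\<close>)
      with \<mu>'(1) show "\<mu> \<in> S"
        by simp
    qed (use \<mu> in blast)
  qed
qed

lemma measurable_add_point_Q: "(\<lambda>(x, \<mu>). add_point \<mu> x) \<in> M \<Otimes>\<^sub>M Q \<rightarrow>\<^sub>M Q"
  using measurable_add_point[of M]
  by (simp add: measurable_cong_sets[OF sets_pair_measure_cong[OF refl sets_Q] sets_Q])

text \<open>Both sides agree on the pi-system of finite-dimensional events by the grid version;
  finite intensity of \<open>C\<close> makes them finite measures, so they agree everywhere.\<close>

lemma mecke_measure:
  assumes C: "C \<in> sets M" "emeasure M C < \<infinity>"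
  shows "density Q (\<lambda>\<mu>. emeasure \<mu> C) =
    distr (density M (indicator C) \<Otimes>\<^sub>M Q) Q (\<lambda>(x, \<mu>). add_point \<mu> x)" (is "?L = ?R")
proof (rule measure_eqI_generator_eq[where A = "\<lambda>_. point_measures M"])
  have L: "emeasure ?L S = (\<integral>\<^sup>+\<mu>. emeasure \<mu> C * indicator S \<mu> \<partial>Q)" if "S \<in> sets Q" for S
    using that measurable_emeasure_Q[OF C(1)] by (simp add: emeasure_density)
  have meas: "(\<lambda>(x, \<mu>). add_point \<mu> x) \<in> density M (indicator C) \<Otimes>\<^sub>M Q \<rightarrow>\<^sub>M Q"
    using measurable_add_point_Q by (simp cong: measurable_cong_sets sets_pair_measure_cong)
  have R: "emeasure ?R S = (\<integral>\<^sup>+x. indicator C x * emeasure Q {\<mu> \<in> space Q. add_point \<mu> x \<in> S} \<partial>M)"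
    if S: "S \<in> sets Q" for S
  proof -
    let ?V = "(\<lambda>(x, \<mu>). add_point \<mu> x) -` S \<inter> space (M \<Otimes>\<^sub>M Q)"
    have V: "?V \<in> sets (M \<Otimes>\<^sub>M Q)"
      using measurable_sets[OF measurable_add_point_Q S] .
    have "emeasure ?R S = emeasure (density M (indicator C) \<Otimes>\<^sub>M Q) ?V"
      by (simp add: emeasure_distr[OF meas S] space_pair_measure)
    also have "\<dots> = (\<integral>\<^sup>+x. emeasure Q (Pair x -` ?V) \<partial>density M (indicator C))"
      using V by (intro Q.emeasure_pair_measure_alt) (simp cong: sets_pair_measure_cong)
    also have "\<dots> = (\<integral>\<^sup>+x. indicator C x * emeasure Q (Pair x -` ?V) \<partial>M)"
      using C V by (intro nn_integral_density Q.measurable_emeasure_Pair) simp_all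
    also have "\<dots> = (\<integral>\<^sup>+x. indicator C x * emeasure Q {\<mu> \<in> space Q. add_point \<mu> x \<in> S} \<partial>M)"
      by (intro nn_integral_cong arg_cong2[where f = "(*)"] arg_cong[where f = "emeasure Q"] refl)
        (auto simp: space_pair_measure)
    finally show ?thesis .
  qed
  show eq: "emeasure ?L S = emeasure ?R S" if S: "S \<in> finite_dim_events M" for S
  proof -
    have SQ: "S \<in> sets Q"
      using sets_finite_dim_events[OF S] by (simp add: sets_Q)
    obtain A m Z J K where grid: "poisson_grid M Q A m Z" and J: "J \<subseteq> {..<m}" "C \<union> Z = (\<Union>i\<in>J. A i) \<union> Z"
      and K: "\<And>\<mu>. \<mu> \<in> poisson_grid.good M A m Z \<Longrightarrow> \<mu> \<in> S \<longleftrightarrow> counts A m \<mu> \<in> K"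
      using finite_dim_grid[OF S C] by metis
    show ?thesis
      unfolding L[OF SQ] R[OF SQ] by (rule poisson_grid.mecke_grid[OF grid C(1) J SQ K])
  qed
  show "Int_stable (finite_dim_events M)"
    by (rule Int_stable_finite_dim_events)
  show "finite_dim_events M \<subseteq> Pow (point_measures M)"
    using finite_dim_events_subset by blast
  show "sets ?L = sigma_sets (point_measures M) (finite_dim_events M)"
    "sets ?R = sigma_sets (point_measures M) (finite_dim_events M)"
    by (simp_all add: sets_Q sets_point_measure_space_finite_dim[OF sigma_finite_measure_axioms])
  show "range (\<lambda>_. point_measures M) \<subseteq> finite_dim_events M"
    using finite_dim_events_space by blast
  \<comment> \<open>Finiteness of the total mass is read off the right-hand side, where it is at
    most the intensity of \<open>C\<close>.\<close>
  have "emeasure ?L (point_measures M) = emeasure ?R (point_measures M)"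
    by (rule eq[OF finite_dim_events_space])
  also have "\<dots> = (\<integral>\<^sup>+x. indicator C x * emeasure Q {\<mu> \<in> space Q. add_point \<mu> x \<in> space Q} \<partial>M)"
    using R[OF sets.top] by (simp add: space_Q)
  also have "\<dots> \<le> (\<integral>\<^sup>+x. indicator C x \<partial>M)"
    using Q.measure_le_1 by (intro nn_integral_mono) (auto simp: indicator_def)
  also have "\<dots> < \<infinity>"
    using C by simp
  finally show "emeasure ?L (point_measures M) \<noteq> \<infinity>" for i :: nat
    by simp
qed simp

end

section \<open>The Mecke equation for bounded functionals\<close>

lemma add_one_cost_bounded:
  assumes "\<And>\<mu>. \<mu> \<in> point_measures M \<Longrightarrow> \<bar>G \<mu>\<bar> \<le> c" "\<mu> \<in> point_measures M"
  shows "\<bar>add_one_cost x G \<mu>\<bar> \<le> 2 * c"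
  using assms(1)[OF assms(2)] assms(1)[OF add_point_in_point_measures[OF assms(2), of x]]
  unfolding add_one_cost_def by linarith

context poisson_law
begin

lemma measurable_add_point_case_prod:
  assumes "G \<in> borel_measurable Q"
  shows "(\<lambda>(x, \<mu>). G (add_point \<mu> x)) \<in> borel_measurable (M \<Otimes>\<^sub>M Q)"
  using measurable_compose[OF measurable_add_point_Q assms] by (simp add: split_beta')

lemma measurable_add_point_fixed:
  assumes "G \<in> borel_measurable Q" "x \<in> space M"
  shows "(\<lambda>\<mu>. G (add_point \<mu> x)) \<in> borel_measurable Q"
  using measurable_compose[OF measurable_Pair1'[OF assms(2)] measurable_add_point_case_prod[OF assms(1)]]
  by simp

lemma measurable_add_one_cost_case_prod:
  assumes "G \<in> borel_measurable Q"
  shows "(\<lambda>(x, \<mu>). add_one_cost x G \<mu>) \<in> borel_measurable (M \<Otimes>\<^sub>M Q)"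
  using measurable_add_point_case_prod[OF assms] measurable_compose[OF measurable_snd assms]
  unfolding add_one_cost_def split_beta' by (rule borel_measurable_diff)

lemma measurable_add_one_cost:
  assumes "G \<in> borel_measurable Q" "x \<in> space M"
  shows "add_one_cost x G \<in> borel_measurable Q"
  using measurable_add_point_fixed[OF assms] assms(1)
  unfolding add_one_cost_def[abs_def] by (rule borel_measurable_diff)

lemma integrable_bounded:
  assumes "G \<in> borel_measurable Q" "\<And>\<mu>. \<mu> \<in> point_measures M \<Longrightarrow> \<bar>G \<mu>\<bar> \<le> c"
  shows "integrable Q (G :: _ \<Rightarrow> real)"
  using assms by (intro Q.integrable_const_bound[where B = c]) (auto simp: space_Q)

lemma integrable_bounded_on_finite:
  fixes h :: "'a \<Rightarrow> real"
  assumes "C \<in> sets M" "emeasure M C < \<infinity>" "h \<in> borel_measurable M" "\<And>x. x \<in> space M \<Longrightarrow> \<bar>h x\<bar> \<le> c"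
  shows "integrable M (\<lambda>x. indicator C x * h x)"
proof (rule Bochner_Integration.integrable_bound)
  show "integrable M (\<lambda>x. indicator C x * c)"
    using assms by (intro integrable_mult_left integrable_real_indicator)
  show "AE x in M. norm (indicator C x * h x) \<le> norm (indicator C x * c)"
    using AE_space by eventually_elim (use assms(4) in \<open>force simp: abs_mult indicator_def\<close>)
qed (use assms in measurable)

lemma Fubini_bounded_on_finite:
  fixes h :: "'a \<Rightarrow> 'a measure \<Rightarrow> real"
  assumes C: "C \<in> sets M" "emeasure M C < \<infinity>"
    and h: "(\<lambda>(x, \<mu>). h x \<mu>) \<in> borel_measurable (M \<Otimes>\<^sub>M Q)"
    and bound: "\<And>x \<mu>. x \<in> space M \<Longrightarrow> \<mu> \<in> point_measures M \<Longrightarrow> \<bar>h x \<mu>\<bar> \<le> c"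
  shows "(\<integral>\<mu>. (\<integral>x. indicator C x * h x \<mu> \<partial>M) \<partial>Q) = (\<integral>x. indicator C x * (\<integral>\<mu>. h x \<mu> \<partial>Q) \<partial>M)"
proof -
  interpret pair: pair_sigma_finite M Q
    by unfold_locales
  have "integrable (M \<Otimes>\<^sub>M Q) (\<lambda>(x, \<mu>). indicator C x * h x \<mu>)"
  proof (rule Bochner_Integration.integrable_bound)
    have "emeasure (M \<Otimes>\<^sub>M Q) (C \<times> space Q) < \<infinity>"
      using C by (simp add: Q.emeasure_pair_measure_Times Q.emeasure_space_1)
    then show "integrable (M \<Otimes>\<^sub>M Q) (\<lambda>z. indicator (C \<times> space Q) z * c)"
      using C by (intro integrable_mult_left integrable_real_indicator) auto
    show "AE z in M \<Otimes>\<^sub>M Q. norm (case z of (x, \<mu>) \<Rightarrow> indicator C x * h x \<mu>)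
        \<le> norm (indicator (C \<times> space Q) z * c)"
      using AE_space by eventually_elim
        (use bound in \<open>force simp: abs_mult indicator_def space_pair_measure space_Q\<close>)
    have "(\<lambda>z. indicator C (fst z) :: real) \<in> borel_measurable (M \<Otimes>\<^sub>M Q)"
      by (rule measurable_compose[OF measurable_fst borel_measurable_indicator[OF C(1)]])
    then show "(\<lambda>(x, \<mu>). indicator C x * h x \<mu>) \<in> borel_measurable (M \<Otimes>\<^sub>M Q)"
      using h unfolding split_beta' by (rule borel_measurable_times)
  qed
  from pair.Fubini_integral[OF this] show ?thesis
    by simp
qed

text \<open>The identity of measures, integrated against \<open>G\<close>. Finite intensity of
  \<open>C\<close> and the bound on \<open>G\<close> make the integrand integrable on the product
  space, so that the integral there can be iterated.\<close>

lemma mecke_integral: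
  assumes C: "C \<in> sets M" "emeasure M C < \<infinity>"
    and G: "G \<in> borel_measurable Q" "\<And>\<mu>. \<mu> \<in> point_measures M \<Longrightarrow> \<bar>G \<mu>\<bar> \<le> c"
  shows "(\<integral>\<mu>. measure \<mu> C * G \<mu> \<partial>Q) = (\<integral>x. indicator C x * (\<integral>\<mu>. G (add_point \<mu> x) \<partial>Q) \<partial>M)"
proof -
  have m: "(\<lambda>\<mu>. measure \<mu> C) \<in> borel_measurable Q"
    using measurable_emeasure_Q[OF C(1)] unfolding measure_def by measurable
  have indC: "(indicator C :: 'a \<Rightarrow> real) \<in> borel_measurable M"
    using C(1) by simp
  let ?MC = "density M (\<lambda>x. ennreal (indicator C x))"
  have sets_MC: "sets (?MC \<Otimes>\<^sub>M Q) = sets (M \<Otimes>\<^sub>M Q)"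
    by (intro sets_pair_measure_cong) simp_all
  have meas: "(\<lambda>(x, \<mu>). add_point \<mu> x) \<in> ?MC \<Otimes>\<^sub>M Q \<rightarrow>\<^sub>M Q"
    using measurable_add_point_Q measurable_cong_sets[OF sets_MC refl] by blast
  \<comment> \<open>The real-valued \<open>measure\<close> replaces \<open>emeasure\<close>; they
    disagree only where the count is infinite, which has probability zero.\<close>
  have "density Q (\<lambda>\<mu>. emeasure \<mu> C) = density Q (\<lambda>\<mu>. ennreal (measure \<mu> C))"
  proof (rule density_cong)
    show "AE \<mu> in Q. emeasure \<mu> C = ennreal (measure \<mu> C)"
      using AE_emeasure_finite[OF C] by eventually_elim (simp add: emeasure_eq_ennreal_measure)
  qed (use m measurable_emeasure_Q[OF C(1)] in auto)
  then have eq: "density Q (\<lambda>\<mu>. ennreal (measure \<mu> C)) = distr (?MC \<Otimes>\<^sub>M Q) Q (\<lambda>(x, \<mu>). add_point \<mu> x)"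
    using mecke_measure[OF C] by (simp add: ennreal_indicator)
  have "(\<integral>\<mu>. measure \<mu> C * G \<mu> \<partial>Q) = (\<integral>\<mu>. G \<mu> \<partial>density Q (\<lambda>\<mu>. ennreal (measure \<mu> C)))"
    using m G(1) by (simp add: integral_real_density)
  also have "\<dots> = (\<integral>z. G (case z of (x, \<mu>) \<Rightarrow> add_point \<mu> x) \<partial>(?MC \<Otimes>\<^sub>M Q))"
    unfolding eq using meas G(1) by (rule integral_distr)
  also have "\<dots> = (\<integral>(x, \<mu>). G (add_point \<mu> x) \<partial>(?MC \<Otimes>\<^sub>M Q))"
    by (simp add: split_beta')
  also have "\<dots> = (\<integral>x. (\<integral>\<mu>. G (add_point \<mu> x) \<partial>Q) \<partial>?MC)"
  proof -
    have fin: "finite_measure ?MC"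
    proof
      have "emeasure ?MC (space M) = emeasure M C"
        using C by (simp add: emeasure_density ennreal_indicator sets.sets_into_space Int_absorb2)
      also have "\<dots> < \<infinity>"
        by (rule C(2))
      finally show "emeasure ?MC (space ?MC) \<noteq> \<infinity>"
        by auto
    qed
    interpret MC: finite_measure ?MC
      by (rule fin)
    interpret pair: pair_sigma_finite ?MC Q
      by unfold_locales
    have "emeasure (?MC \<Otimes>\<^sub>M Q) (space (?MC \<Otimes>\<^sub>M Q)) = emeasure ?MC (space ?MC) * emeasure Q (space Q)"
      unfolding space_pair_measure by (rule Q.emeasure_pair_measure_Times) auto
    also have "\<dots> < \<infinity>"
      using MC.emeasure_finite[of "space ?MC", unfolded infinity_ennreal_def top.not_eq_extremum]
      unfolding Q.emeasure_space_1 infinity_ennreal_def mult_1_right .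
    finally have "emeasure (?MC \<Otimes>\<^sub>M Q) (space (?MC \<Otimes>\<^sub>M Q)) \<noteq> \<infinity>"
      by simp
    then interpret P: finite_measure "?MC \<Otimes>\<^sub>M Q"
      by (rule finite_measureI)
    have "integrable (?MC \<Otimes>\<^sub>M Q) (\<lambda>(x, \<mu>). G (add_point \<mu> x))"
    proof (rule P.integrable_const_bound[where B = c])
      show "AE z in ?MC \<Otimes>\<^sub>M Q. norm (case z of (x, \<mu>) \<Rightarrow> G (add_point \<mu> x)) \<le> c"
        using AE_space by eventually_elim
          (auto simp: space_pair_measure space_Q intro!: G(2) add_point_in_point_measures)
      show "(\<lambda>(x, \<mu>). G (add_point \<mu> x)) \<in> borel_measurable (?MC \<Otimes>\<^sub>M Q)"
        using measurable_add_point_case_prod[OF G(1)] measurable_cong_sets[OF sets_MC refl] by blast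
    qed
    then show ?thesis
      by (rule pair.integral_fst'[symmetric, of "\<lambda>(x, \<mu>). G (add_point \<mu> x)", simplified])
  qed
  also have "\<dots> = (\<integral>x. indicator C x * (\<integral>\<mu>. G (add_point \<mu> x) \<partial>Q) \<partial>M)"
    using indC by (intro integral_real_density Q.borel_measurable_lebesgue_integral
        measurable_add_point_case_prod[OF G(1)]) auto
  finally show ?thesis .
qed

text \<open>The Mecke equation with the indicator of the null set \<open>T\<close> on the left gives
  0, so for almost every \<open>x\<close> the configuration with \<open>x\<close> added avoids
  \<open>T\<close> almost surely. This makes add-one costs insensitive to changes of
  \<open>F\<close> on a null set.\<close>

lemma AE_add_point:
  assumes S: "S \<in> sets Q" and AE: "AE \<mu> in Q. \<mu> \<in> S"
  shows "AE x in M. AE \<mu> in Q. add_point \<mu> x \<in> S"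
proof -
  define T where "T = space Q - S"
  have T: "T \<in> sets Q" "AE \<mu> in Q. \<mu> \<notin> T"
    using S AE by (auto simp: T_def)
  let ?e = "\<lambda>x. \<integral>\<mu>. (indicator T (add_point \<mu> x) :: real) \<partial>Q"
  have meas_T: "(indicator T :: _ \<Rightarrow> real) \<in> borel_measurable Q"
    using T(1) by simp
  have e_meas: "?e \<in> borel_measurable M"
    by (rule Q.borel_measurable_lebesgue_integral[OF measurable_add_point_case_prod[OF meas_T]])
  have e_nonneg: "0 \<le> ?e x" for x
    by simp
  have e_le: "\<bar>?e x\<bar> \<le> 1" if "x \<in> space M" for x
  proof -
    have "?e x \<le> (\<integral>\<mu>. 1 \<partial>Q)"
    proof (rule integral_mono)
      show "integrable Q (\<lambda>\<mu>. indicator T (add_point \<mu> x) :: real)"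
        using measurable_add_point_fixed[OF meas_T that] by (rule integrable_bounded[where c = 1]) simp
    qed (simp_all add: indicator_def)
    then show ?thesis
      using e_nonneg[of x] by (simp add: Q.prob_space)
  qed
  \<comment> \<open>The Mecke equation is available on sets of finite intensity, so the space is
    exhausted by countably many of them.\<close>
  obtain X :: "nat \<Rightarrow> 'a set" where X: "range X \<subseteq> sets M" "(\<Union>i. X i) = space M"
    "\<And>i. emeasure M (X i) \<noteq> \<infinity>"
    using sigma_finite by blast
  have null_piece: "AE x in M. indicator (X n) x * ?e x = 0" for n
  proof -
    have Xn: "X n \<in> sets M" "emeasure M (X n) < \<infinity>"
      using X by (auto simp: top.not_eq_extremum)
    have "(\<integral>x. indicator (X n) x * ?e x \<partial>M) = (\<integral>\<mu>. measure \<mu> (X n) * indicator T \<mu> \<partial>Q)"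
      by (rule mecke_integral[OF Xn meas_T, where c = 1, symmetric]) (simp add: indicator_def)
    also have "\<dots> = (\<integral>\<mu>. 0 \<partial>Q)"
    proof (rule integral_cong_AE)
      show "(\<lambda>\<mu>. measure \<mu> (X n) * indicator T \<mu>) \<in> borel_measurable Q"
        using measurable_emeasure_Q[OF Xn(1)] T(1) unfolding measure_def by measurable
      show "AE \<mu> in Q. measure \<mu> (X n) * indicator T \<mu> = 0"
        using T(2) by eventually_elim simp
    qed simp
    finally have "(\<integral>x. indicator (X n) x * ?e x \<partial>M) = 0"
      by simp
    moreover have "integrable M (\<lambda>x. indicator (X n) x * ?e x)"
      using Xn e_meas e_le by (rule integrable_bounded_on_finite)
    ultimately show ?thesis
      using e_nonneg by (subst (asm) integral_nonneg_eq_0_iff_AE) auto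
  qed
  have "AE x in M. \<forall>n. indicator (X n) x * ?e x = 0"
    unfolding AE_all_countable by (rule allI[OF null_piece])
  then have "AE x in M. x \<in> space M \<and> ?e x = 0"
    using AE_space
  proof eventually_elim
    fix x assume x: "\<forall>n. indicator (X n) x * ?e x = 0" "x \<in> space M"
    then obtain n where "x \<in> X n"
      using X(2) by blast
    then show "x \<in> space M \<and> ?e x = 0"
      using x spec[OF x(1), of n] by simp
  qed
  then show ?thesis
  proof eventually_elim
    fix x assume x: "x \<in> space M \<and> ?e x = 0"
    have "AE \<mu> in Q. indicator T (add_point \<mu> x) = (0 :: real)"
    proof (subst integral_nonneg_eq_0_iff_AE[symmetric])
      show "integrable Q (\<lambda>\<mu>. indicator T (add_point \<mu> x) :: real)"
        using measurable_add_point_fixed[OF meas_T conjunct1[OF x]]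
        by (rule integrable_bounded[where c = 1]) simp
    qed (use x in auto)
    then show "AE \<mu> in Q. add_point \<mu> x \<in> S"
      using AE_space
      by eventually_elim (auto simp: T_def space_Q indicator_def add_point_in_point_measures split: if_splits)
  qed
qed

end

section \<open>Conditioning on the counts\<close>

context poisson_law
begin

lemma measurable_measure_Q: "B \<in> sets M \<Longrightarrow> (\<lambda>\<mu>. measure \<mu> B) \<in> borel_measurable Q"
  unfolding measure_def by (rule borel_measurable_enn2real[OF measurable_emeasure_Q])

lemma bound_nonneg:
  assumes "\<And>\<mu>. \<mu> \<in> point_measures M \<Longrightarrow> \<bar>G \<mu>\<bar> \<le> (c :: real)"
  shows "0 \<le> c"
proof -
  obtain \<mu> where "\<mu> \<in> point_measures M"
    using Q.not_empty by (auto simp: space_Q)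
  from assms[OF this] show ?thesis
    by linarith
qed

end

context poisson_grid
begin

text \<open>This is \<open>E[G | N = k]\<close>, with value \<open>0\<close> (division by \<open>0\<close>) unless all elements of \<open>k\<close> are indices of
  cells.\<close>

definition cond :: "('a measure \<Rightarrow> real) \<Rightarrow> nat multiset \<Rightarrow> real" where
  "cond G k = (\<integral>\<mu>. indicator {k} (N \<mu>) * G \<mu> \<partial>Q) / measure \<nu> {k}"

lemma indicator_counts_measurable: "(\<lambda>\<mu>. indicator K (N \<mu>) :: real) \<in> borel_measurable Q"
  by (rule measurable_compose[OF measurable_counts]) simp

lemma integrable_cell:
  fixes G :: "'a measure \<Rightarrow> real"
  assumes "G \<in> borel_measurable Q" "\<And>\<mu>. \<mu> \<in> point_measures M \<Longrightarrow> \<bar>G \<mu>\<bar> \<le> c"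
  shows "integrable Q (\<lambda>\<mu>. indicator K (N \<mu>) * G \<mu>)"
proof (rule integrable_bounded[where c = c])
  show "\<bar>indicator K (N \<mu>) * G \<mu>\<bar> \<le> c" if "\<mu> \<in> point_measures M" for \<mu>
    using assms(2)[OF that] bound_nonneg[of G, OF assms(2)] by (simp add: indicator_def)
qed (intro borel_measurable_times indicator_counts_measurable assms(1))

lemma integral_indicator_counts: "(\<integral>\<mu>. indicator K (N \<mu>) * c \<partial>Q) = measure \<nu> K * c"
proof -
  have "(\<integral>\<mu>. (indicator K (N \<mu>) :: real) \<partial>Q) = (\<integral>k. indicator K k \<partial>\<nu>)"
    by (rule integral_distr[symmetric, OF measurable_counts]) simp
  then show ?thesis
    by simp
qed

text \<open>An almost sure hypothesis suffices for a conclusion at every \<open>k\<close>: the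
  numerators are integrals, and they are divided by the same number. At \<open>k\<close> of
  probability zero both sides are 0.\<close>

lemma cond_mono:
  assumes G: "G \<in> borel_measurable Q" "\<And>\<mu>. \<mu> \<in> point_measures M \<Longrightarrow> \<bar>G \<mu>\<bar> \<le> c"
    and H: "H \<in> borel_measurable Q" "\<And>\<mu>. \<mu> \<in> point_measures M \<Longrightarrow> \<bar>H \<mu>\<bar> \<le> c"
    and le: "AE \<mu> in Q. G \<mu> \<le> H \<mu>"
  shows "cond G k \<le> cond H k"
  unfolding cond_def
proof (intro divide_right_mono integral_mono_AE)
  show "AE \<mu> in Q. indicator {k} (N \<mu>) * G \<mu> \<le> indicator {k} (N \<mu>) * H \<mu>"
    using le by eventually_elim (auto intro: mult_left_mono)
qed (auto intro: integrable_cell[OF G] integrable_cell[OF H])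

lemma cond_const: "set_mset k \<subseteq> {..<m} \<Longrightarrow> cond (\<lambda>_. c) k = c"
  using measure_\<nu>_pos[of k] by (simp only: cond_def integral_indicator_counts) simp

lemma cond_abs_le:
  assumes G: "G \<in> borel_measurable Q" "\<And>\<mu>. \<mu> \<in> point_measures M \<Longrightarrow> \<bar>G \<mu>\<bar> \<le> c"
    and k: "set_mset k \<subseteq> {..<m}"
  shows "\<bar>cond G k\<bar> \<le> c"
proof -
  have c: "\<bar>c\<bar> \<le> c"
    using bound_nonneg[of G, OF G(2)] by simp
  have "cond G k \<le> cond (\<lambda>_. c) k" "cond (\<lambda>_. - c) k \<le> cond G k"
    using G c AE_space
    by (intro cond_mono[where c = c]; force simp: space_Q elim!: eventually_mono)+
  then show ?thesis
    unfolding cond_const[OF k] by linarith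
qed

lemma cond_diff:
  assumes "G \<in> borel_measurable Q" "\<And>\<mu>. \<mu> \<in> point_measures M \<Longrightarrow> \<bar>G \<mu>\<bar> \<le> c"
    and "H \<in> borel_measurable Q" "\<And>\<mu>. \<mu> \<in> point_measures M \<Longrightarrow> \<bar>H \<mu>\<bar> \<le> c"
  shows "cond (\<lambda>\<mu>. G \<mu> - H \<mu>) k = cond G k - cond H k"
  unfolding cond_def
  by (simp add: right_diff_distrib diff_divide_distrib
      Bochner_Integration.integral_diff[OF integrable_cell[OF assms(1,2)] integrable_cell[OF assms(3,4)]])

lemma measurable_cond_case_prod:
  assumes "(\<lambda>(x, \<mu>). h x \<mu>) \<in> borel_measurable (M \<Otimes>\<^sub>M Q)"
  shows "(\<lambda>x. cond (h x) k) \<in> borel_measurable M"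
proof -
  have "(\<lambda>z. indicator {k} (N (snd z)) * (case z of (x, \<mu>) \<Rightarrow> h x \<mu>) :: real) \<in> borel_measurable (M \<Otimes>\<^sub>M Q)"
    by (rule borel_measurable_times[OF measurable_compose[OF measurable_snd indicator_counts_measurable] assms])
  then have "(\<lambda>x. \<integral>\<mu>. indicator {k} (N \<mu>) * h x \<mu> \<partial>Q) \<in> borel_measurable M"
    by (intro Q.borel_measurable_lebesgue_integral) (simp add: split_beta')
  then show ?thesis
    unfolding cond_def by (rule borel_measurable_divide) simp
qed

text \<open>The Mecke equation for the indicator of \<open>N = k + e_i\<close> times
  \<open>G\<close>: a point added in cell \<open>i\<close> turns this event into
  \<open>N = k\<close>. The factor from the count on one side and the ratio of the two probabilities
  combine to \<open>1 / \<lambda>(A_i)\<close>.\<close>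

lemma cond_add_mset:
  assumes i: "i < m" and k: "set_mset k \<subseteq> {..<m}"
    and G: "G \<in> borel_measurable Q" "\<And>\<mu>. \<mu> \<in> point_measures M \<Longrightarrow> \<bar>G \<mu>\<bar> \<le> c"
  shows "cond G (add_mset i k) =
    (\<integral>x. indicator (A i) x * cond (\<lambda>\<mu>. G (add_point \<mu> x)) k \<partial>M) / measure M (A i)"
proof -
  let ?H = "\<lambda>\<mu>. indicator {add_mset i k} (N \<mu>) * G \<mu>"
  have "?H \<in> borel_measurable Q"
    by (rule borel_measurable_times[OF indicator_counts_measurable G(1)])
  moreover have "\<bar>?H \<mu>\<bar> \<le> c" if "\<mu> \<in> point_measures M" for \<mu>
    using G(2)[OF that] bound_nonneg[of G, OF G(2)] by (simp add: indicator_def)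
  ultimately have H: "?H \<in> borel_measurable Q" "\<And>\<mu>. \<mu> \<in> point_measures M \<Longrightarrow> \<bar>?H \<mu>\<bar> \<le> c"
    by blast+
  \<comment> \<open>Where \<open>?H\<close> does not vanish, cell \<open>i\<close> contains exactly
    \<open>count k i + 1\<close> points.\<close>
  have "real (Suc (count k i)) * (\<integral>\<mu>. ?H \<mu> \<partial>Q) = (\<integral>\<mu>. measure \<mu> (A i) * ?H \<mu> \<partial>Q)"
    unfolding integral_mult_right_zero[symmetric]
  proof (rule integral_cong_AE)
    show "(\<lambda>\<mu>. measure \<mu> (A i) * ?H \<mu>) \<in> borel_measurable Q"
      by (rule borel_measurable_times[OF measurable_measure_Q[OF cell_sets[OF i]] H(1)])
    show "AE \<mu> in Q. real (Suc (count k i)) * ?H \<mu> = measure \<mu> (A i) * ?H \<mu>"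
      using AE_good
    proof eventually_elim
      fix \<mu> assume "\<mu> \<in> good"
      from emeasure_good[OF this i] have "measure \<mu> (A i) = real (count (N \<mu>) i)"
        by (simp add: measure_def)
      then show "real (Suc (count k i)) * ?H \<mu> = measure \<mu> (A i) * ?H \<mu>"
        by (simp add: indicator_def)
    qed
  qed (intro borel_measurable_times H(1) borel_measurable_const)
  also have "\<dots> = (\<integral>x. indicator (A i) x * (\<integral>\<mu>. ?H (add_point \<mu> x) \<partial>Q) \<partial>M)"
    by (rule mecke_integral[OF cell_sets[OF i] _ H]) (use cell_finite[OF i] in simp)
  also have "\<dots> = (\<integral>x. indicator (A i) x * (cond (\<lambda>\<mu>. G (add_point \<mu> x)) k * measure \<nu> {k}) \<partial>M)"
  proof (rule Bochner_Integration.integral_cong[OF refl])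
    fix x assume x: "x \<in> space M"
    show "indicator (A i) x * (\<integral>\<mu>. ?H (add_point \<mu> x) \<partial>Q) =
        indicator (A i) x * (cond (\<lambda>\<mu>. G (add_point \<mu> x)) k * measure \<nu> {k})"
    proof (cases "x \<in> A i")
      case True
      have "(\<integral>\<mu>. ?H (add_point \<mu> x) \<partial>Q) = (\<integral>\<mu>. indicator {k} (N \<mu>) * G (add_point \<mu> x) \<partial>Q)"
      proof (rule integral_cong_AE)
        show "AE \<mu> in Q. ?H (add_point \<mu> x) = indicator {k} (N \<mu>) * G (add_point \<mu> x)"
          using AE_good by eventually_elim (auto simp: add_point_good(2)[OF _ i True] indicator_def)
      qed (intro measurable_add_point_fixed[OF H(1) x] borel_measurable_times
          indicator_counts_measurable measurable_add_point_fixed[OF G(1) x])+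
      also have "\<dots> = cond (\<lambda>\<mu>. G (add_point \<mu> x)) k * measure \<nu> {k}"
        using measure_\<nu>_pos[OF k] by (simp add: cond_def)
      finally show ?thesis
        by simp
    qed simp
  qed
  also have "\<dots> = (\<integral>x. indicator (A i) x * cond (\<lambda>\<mu>. G (add_point \<mu> x)) k \<partial>M) * measure \<nu> {k}"
    unfolding mult.assoc[symmetric] by (rule integral_mult_left_zero)
  finally have "real (Suc (count k i)) * (\<integral>\<mu>. ?H \<mu> \<partial>Q) =
      (\<integral>x. indicator (A i) x * cond (\<lambda>\<mu>. G (add_point \<mu> x)) k \<partial>M) * measure \<nu> {k}" .
  \<comment> \<open>Multiplying by the intensity produces the right side of
    \<open>measure_\<nu>_add_mset\<close>, which trades \<open>{k}\<close> for
    \<open>{add_mset i k}\<close> and lets the factor \<open>Suc (count k i)\<close> cancel.\<close>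
  then have "real (Suc (count k i)) * ((\<integral>\<mu>. ?H \<mu> \<partial>Q) * measure M (A i)) =
      (\<integral>x. indicator (A i) x * cond (\<lambda>\<mu>. G (add_point \<mu> x)) k \<partial>M) * (measure M (A i) * measure \<nu> {k})"
    by (drule_tac arg_cong[where f = "\<lambda>t. t * measure M (A i)"]) (simp only: ac_simps)
  also have "\<dots> = real (Suc (count k i)) *
      ((\<integral>x. indicator (A i) x * cond (\<lambda>\<mu>. G (add_point \<mu> x)) k \<partial>M) * measure \<nu> {add_mset i k})"
    unfolding measure_\<nu>_add_mset[OF i, symmetric] by (simp only: mult.left_commute)
  finally have "(\<integral>\<mu>. ?H \<mu> \<partial>Q) * measure M (A i) =
      (\<integral>x. indicator (A i) x * cond (\<lambda>\<mu>. G (add_point \<mu> x)) k \<partial>M) * measure \<nu> {add_mset i k}"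
    by (simp only: mult_cancel_left of_nat_eq_0_iff nat.simps simp_thms)
  moreover have "set_mset (add_mset i k) \<subseteq> {..<m}"
    using i k by simp
  ultimately show ?thesis
    using measure_\<nu>_pos[of "add_mset i k"] cell_pos[OF i]
    unfolding cond_def by (simp only: frac_eq_eq less_imp_neq[symmetric] simp_thms)
qed

text \<open>The number \<open>cond G k\<close> is its own average over the cell, so it can be moved
  under the integral of \<open>cond_add_mset\<close>. With \<open>G = F\<close> this expresses first
  differences of the conditional mean, with \<open>G\<close> an add-one cost of \<open>F\<close> its
  second differences.\<close>

lemma cond_add_mset_diff:
  assumes i: "i < m" and k: "set_mset k \<subseteq> {..<m}"
    and G: "G \<in> borel_measurable Q" "\<And>\<mu>. \<mu> \<in> point_measures M \<Longrightarrow> \<bar>G \<mu>\<bar> \<le> c"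
  shows "cond G (add_mset i k) - cond G k =
    (\<integral>x. indicator (A i) x * cond (add_one_cost x G) k \<partial>M) / measure M (A i)"
proof -
  have fin: "emeasure M (A i) < \<infinity>"
    using cell_finite[OF i] by simp
  have Gx: "\<bar>G (add_point \<mu> x)\<bar> \<le> c" if "\<mu> \<in> point_measures M" for \<mu> x
    by (rule G(2)) (rule add_point_in_point_measures[OF that])
  have int: "integrable M (\<lambda>x. indicator (A i) x * cond (\<lambda>\<mu>. G (add_point \<mu> x)) k)"
    by (rule integrable_bounded_on_finite[OF cell_sets[OF i] fin])
      (auto intro: measurable_cond_case_prod measurable_add_point_case_prod[OF G(1)]
        cond_abs_le[OF measurable_add_point_fixed[OF G(1)] Gx k])
  have int_const: "integrable M (\<lambda>x. indicator (A i) x * cond G k)"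
    using cell_sets[OF i] fin by (intro integrable_mult_left integrable_real_indicator)
  have "(\<integral>x. indicator (A i) x * cond (add_one_cost x G) k \<partial>M) =
      (\<integral>x. indicator (A i) x * cond (\<lambda>\<mu>. G (add_point \<mu> x)) k - indicator (A i) x * cond G k \<partial>M)"
  proof (rule Bochner_Integration.integral_cong[OF refl])
    fix x assume x: "x \<in> space M"
    show "indicator (A i) x * cond (add_one_cost x G) k =
        indicator (A i) x * cond (\<lambda>\<mu>. G (add_point \<mu> x)) k - indicator (A i) x * cond G k"
      unfolding add_one_cost_def[abs_def] right_diff_distrib[symmetric]
      by (subst cond_diff[OF measurable_add_point_fixed[OF G(1) x] Gx G]) auto
  qed
  also have "\<dots> = (\<integral>x. indicator (A i) x * cond (\<lambda>\<mu>. G (add_point \<mu> x)) k \<partial>M) - measure M (A i) * cond G k"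
    using int int_const cell_sets[OF i] fin by simp
  finally show ?thesis
    using cell_pos[OF i] cond_add_mset[OF i k G] by (simp add: diff_divide_distrib)
qed

text \<open>The tower property. For nonnegative \<open>H\<close>, the image under \<open>N\<close>
  of \<open>Q\<close> weighted by \<open>H\<close> has density \<open>cond H\<close> with respect to
  \<open>\<nu>\<close>; on a countable space this only needs checking on singletons.\<close>

lemma integral_cond:
  assumes G: "G \<in> borel_measurable Q" "\<And>\<mu>. \<mu> \<in> point_measures M \<Longrightarrow> \<bar>G \<mu>\<bar> \<le> c"
  shows "(\<integral>k. indicator K k * cond G k \<partial>\<nu>) = (\<integral>\<mu>. indicator K (N \<mu>) * G \<mu> \<partial>Q)"
proof -
  interpret \<nu>: prob_space \<nu>
    by (rule prob_space_\<nu>)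
  \<comment> \<open>The shift by the bound makes the functional nonnegative, hence a density; its
    contribution \<open>measure \<nu> K * c\<close> is the same on both sides and is removed at the
    end.\<close>
  define H where "H \<mu> = G \<mu> + c" for \<mu>
  have H: "H \<in> borel_measurable Q" "\<And>\<mu>. \<mu> \<in> point_measures M \<Longrightarrow> 0 \<le> H \<mu>"
    "\<And>\<mu>. \<mu> \<in> point_measures M \<Longrightarrow> \<bar>H \<mu>\<bar> \<le> 2 * c"
    unfolding H_def using G by (auto simp: abs_le_iff) (smt (verit) G(2))+
  have int_H: "integrable Q (\<lambda>\<mu>. indicator K (N \<mu>) * H \<mu>)" for K
    by (rule integrable_cell[OF H(1,3)])
  have cond_H: "cond H k = cond G k + c" if "set_mset k \<subseteq> {..<m}" for k
  proof -
    have "\<bar>c\<bar> \<le> c"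
      using bound_nonneg[of G, OF G(2)] by simp
    then have "cond (\<lambda>\<mu>. G \<mu> - - c) k = cond G k - cond (\<lambda>_. - c) k"
      by (intro cond_diff[OF G]) auto
    then show ?thesis
      by (simp add: H_def[abs_def] cond_const[OF that])
  qed
  let ?L = "distr (density Q H) (count_space UNIV) N"
  let ?R = "density \<nu> (\<lambda>k. ennreal (cond H k))"
  have N': "N \<in> density Q H \<rightarrow>\<^sub>M count_space UNIV"
    using measurable_counts by simp
  have cond_nonneg: "0 \<le> cond H k" for k
    unfolding cond_def using H(2) by (intro divide_nonneg_nonneg integral_nonneg_AE)
      (auto intro!: AE_I2 simp: space_Q indicator_def)
  have L: "emeasure ?L K = ennreal (\<integral>\<mu>. indicator K (N \<mu>) * H \<mu> \<partial>Q)" for K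
  proof -
    have "emeasure ?L K = (\<integral>\<^sup>+\<mu>. ennreal (H \<mu>) * indicator (N -` K \<inter> space Q) \<mu> \<partial>Q)"
      using H(1) measurable_sets[OF measurable_counts, of K]
      by (simp add: emeasure_distr[OF N'] emeasure_density)
    also have "\<dots> = (\<integral>\<^sup>+\<mu>. ennreal (indicator K (N \<mu>) * H \<mu>) \<partial>Q)"
      by (intro nn_integral_cong) (auto simp: indicator_def)
    also have "\<dots> = ennreal (\<integral>\<mu>. indicator K (N \<mu>) * H \<mu> \<partial>Q)"
      using int_H H(2) by (intro nn_integral_eq_integral) (auto intro!: AE_I2 simp: space_Q indicator_def)
    finally show ?thesis .
  qed
  have "?L = ?R"
  proof (rule measure_eqI_countable[where A = UNIV])
    fix k :: "nat multiset"
    have "emeasure ?R {k} = ennreal (cond H k * measure \<nu> {k})"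
      by (simp add: emeasure_density \<nu>.emeasure_eq_measure ennreal_mult cond_nonneg)
    also have "cond H k * measure \<nu> {k} = (\<integral>\<mu>. indicator {k} (N \<mu>) * H \<mu> \<partial>Q)"
    proof (cases "set_mset k \<subseteq> {..<m}")
      case True
      then show ?thesis
        using measure_\<nu>_pos[OF True] by (simp add: cond_def)
    next
      case False
      then have "N \<mu> \<noteq> k" for \<mu>
        using set_counts by blast
      with False show ?thesis
        by (simp add: measure_\<nu>_singleton)
    qed
    finally show "emeasure ?L {k} = emeasure ?R {k}"
      unfolding L by simp
  qed (simp_all add: countable_UNIV_multiset)
  have "(\<integral>\<mu>. H \<mu> * indicator K (N \<mu>) \<partial>Q) = (\<integral>\<mu>. indicator K (N \<mu>) \<partial>density Q H)"
    using H by (intro integral_real_density[symmetric] indicator_counts_measurable)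
      (auto intro!: AE_I2 simp: space_Q)
  also have "\<dots> = (\<integral>k. indicator K k \<partial>?L)"
    by (rule integral_distr[OF N', symmetric]) simp
  also have "\<dots> = (\<integral>k. indicator K k \<partial>?R)"
    unfolding \<open>?L = ?R\<close> ..
  also have "\<dots> = (\<integral>k. cond H k * indicator K k \<partial>\<nu>)"
    using cond_nonneg by (intro integral_real_density) auto
  finally have "(\<integral>k. indicator K k * cond H k \<partial>\<nu>) = (\<integral>\<mu>. indicator K (N \<mu>) * H \<mu> \<partial>Q)"
    by (simp add: mult.commute)
  moreover have "(\<integral>k. indicator K k * cond H k \<partial>\<nu>) = (\<integral>k. indicator K k * cond G k \<partial>\<nu>) + measure \<nu> K * c"
  proof -
    have "(\<integral>k. indicator K k * cond H k \<partial>\<nu>) = (\<integral>k. indicator K k * cond G k + indicator K k * c \<partial>\<nu>)"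
      using AE_\<nu> by (intro integral_cong_AE) (auto simp: cond_H distrib_left)
    also have "\<dots> = (\<integral>k. indicator K k * cond G k \<partial>\<nu>) + (\<integral>k. indicator K k * c \<partial>\<nu>)"
    proof (rule Bochner_Integration.integral_add)
      have "AE k in \<nu>. norm (indicator K k * cond G k) \<le> c"
        using AE_\<nu>
      proof eventually_elim
        fix k :: "nat multiset" assume "set_mset k \<subseteq> {..<m}"
        from cond_abs_le[OF G this] show "norm (indicator K k * cond G k) \<le> c"
          using bound_nonneg[of G, OF G(2)] by (simp add: indicator_def)
      qed
      then show "integrable \<nu> (\<lambda>k. indicator K k * cond G k)"
        by (rule \<nu>.integrable_const_bound) simp
      show "integrable \<nu> (\<lambda>k. indicator K k * c)"
        by (intro integrable_mult_left integrable_real_indicator) (simp_all add: \<nu>.emeasure_eq_measure)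
    qed
    also have "(\<integral>k. indicator K k * c \<partial>\<nu>) = measure \<nu> K * c"
      by simp
    finally show ?thesis .
  qed
  moreover have "(\<integral>\<mu>. indicator K (N \<mu>) * H \<mu> \<partial>Q) = (\<integral>\<mu>. indicator K (N \<mu>) * G \<mu> \<partial>Q) + measure \<nu> K * c"
  proof -
    have "\<bar>c\<bar> \<le> c"
      using bound_nonneg[of G, OF G(2)] by simp
    then have "integrable Q (\<lambda>\<mu>. indicator K (N \<mu>) * c)"
      by (intro integrable_cell) auto
    then show ?thesis
      unfolding H_def distrib_left
      by (simp only: Bochner_Integration.integral_add[OF integrable_cell[OF G]] integral_indicator_counts)
  qed
  ultimately show ?thesis
    by simp
qed

end

text \<open>Monotonicity allows \<open>l\<close> to be added to \<open>k\<close>. Then the elements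
  of \<open>k\<close> are put on top of \<open>l\<close> one at a time, and by decreasing increments
  each step gains at most what the same step gains at \<open>l\<close>.\<close>

lemma multiset_increasing_concave_le:
  fixes f :: "'i multiset \<Rightarrow> real"
  assumes "finite I"
    and incr: "\<And>k i. set_mset k \<subseteq> I \<Longrightarrow> i \<in> I \<Longrightarrow> f k \<le> f (add_mset i k)"
    and conc: "\<And>k i j. set_mset k \<subseteq> I \<Longrightarrow> i \<in> I \<Longrightarrow> j \<in> I \<Longrightarrow>
      f (add_mset j (add_mset i k)) - f (add_mset j k) \<le> f (add_mset i k) - f k"
    and k: "set_mset k \<subseteq> I" and l: "set_mset l \<subseteq> I"
  shows "f k \<le> f l + (\<Sum>i\<in>I. real (count k i) * (f (add_mset i l) - f l))"
proof -
  have "f k \<le> f (k + l)"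
    using l
  proof (induction l)
    case (add j l)
    then show ?case
      using incr[of "k + l" j] k by simp
  qed simp
  also have "f (k + l) \<le> f l + (\<Sum>i\<in>I. real (count k i) * (f (add_mset i l) - f l))"
    using k
  proof (induction k)
    case (add j k)
    \<comment> \<open>The increment in direction \<open>j\<close> only decreases while the base
      point grows from \<open>l\<close> to \<open>k + l\<close>.\<close>
    have "f (add_mset j (k + l)) - f (k + l) \<le> f (add_mset j l) - f l"
      using add.prems
    proof (induction k)
      case (add a k)
      then show ?case
        using conc[of "k + l" j a] l by (simp add: add_mset_commute)
    qed simp
    moreover have "(\<Sum>i\<in>I. real (count (add_mset j k) i) * (f (add_mset i l) - f l)) =
        (\<Sum>i\<in>I. real (count k i) * (f (add_mset i l) - f l) + (if i = j then f (add_mset i l) - f l else 0))"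
      by (intro sum.cong) (auto simp: algebra_simps)
    moreover have "\<dots> = (\<Sum>i\<in>I. real (count k i) * (f (add_mset i l) - f l)) + (f (add_mset j l) - f l)"
      using \<open>finite I\<close> add.prems by (simp add: sum.distrib)
    ultimately show ?case
      using add by simp
  qed simp
  finally show ?thesis .
qed

section \<open>The covariance bound for events in the counts\<close>

context poisson_grid
begin

lemma integrable_count_\<nu>:
  assumes i: "i < m"
  shows "integrable \<nu> (\<lambda>k. real (count k i))" and "(\<integral>k. real (count k i) \<partial>\<nu>) = measure M (A i)"
proof -
  interpret \<nu>: prob_space \<nu>
    by (rule prob_space_\<nu>)
  have "(\<integral>\<^sup>+k. ennreal (real (count k i)) \<partial>\<nu>) = ennreal (measure M (A i))"
    using nn_integral_count_\<nu>[OF i, of UNIV] cell_finite[OF i] \<nu>.emeasure_space_1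
    by (simp add: ennreal_of_nat_eq_real_of_nat[symmetric] emeasure_eq_ennreal_measure)
  then show "integrable \<nu> (\<lambda>k. real (count k i))" "(\<integral>k. real (count k i) \<partial>\<nu>) = measure M (A i)"
    by (auto intro!: integrableI_nn_integral_finite integral_eq_nn_integral[THEN trans])
qed

text \<open>The sign conditions are imposed almost everywhere because they will be applied to a
  truncation that inherits them only in this sense; the truncation itself is bounded
  everywhere.\<close>

context
  fixes F :: "'a measure \<Rightarrow> real" and c :: real
  assumes F: "F \<in> borel_measurable Q" "\<And>\<mu>. \<mu> \<in> point_measures M \<Longrightarrow> \<bar>F \<mu>\<bar> \<le> c"
    and incr: "AE x in M. AE \<mu> in Q. 0 \<le> add_one_cost x F \<mu>"
    and conc: "AE x in M. AE y in M. AE \<mu> in Q. add_one_cost y (add_one_cost x F) \<mu> \<le> 0"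
begin

lemma D_bounded: "\<mu> \<in> point_measures M \<Longrightarrow> \<bar>add_one_cost x F \<mu>\<bar> \<le> 2 * c"
  by (rule add_one_cost_bounded[OF F(2)])

lemma D_measurable: "x \<in> space M \<Longrightarrow> add_one_cost x F \<in> borel_measurable Q"
  by (rule measurable_add_one_cost[OF F(1)])

lemma integrable_cell_cond_D:
  assumes i: "i < m" and k: "set_mset k \<subseteq> {..<m}"
  shows "integrable M (\<lambda>x. indicator (A i) x * cond (add_one_cost x F) k)"
proof (rule integrable_bounded_on_finite[OF cell_sets[OF i]])
  show "emeasure M (A i) < \<infinity>"
    using cell_finite[OF i] by simp
  show "(\<lambda>x. cond (add_one_cost x F) k) \<in> borel_measurable M"
    by (rule measurable_cond_case_prod[OF measurable_add_one_cost_case_prod[OF F(1)]])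
  show "\<bar>cond (add_one_cost x F) k\<bar> \<le> 2 * c" if "x \<in> space M" for x
    by (rule cond_abs_le[OF D_measurable[OF that] D_bounded k])
qed

lemma cond_increasing:
  assumes i: "i < m" and k: "set_mset k \<subseteq> {..<m}"
  shows "cond F k \<le> cond F (add_mset i k)"
proof -
  have "0 \<le> (\<integral>x. indicator (A i) x * cond (add_one_cost x F) k \<partial>M)"
  proof (rule integral_nonneg_AE, use incr AE_space in eventually_elim)
    fix x assume x: "AE \<mu> in Q. 0 \<le> add_one_cost x F \<mu>" "x \<in> space M"
    have "cond (\<lambda>_. 0) k \<le> cond (add_one_cost x F) k"
      by (rule cond_mono[where c = "2 * c", OF _ _ D_measurable[OF x(2)] D_bounded x(1)])
        (use bound_nonneg[of F, OF F(2)] in auto)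
    then show "0 \<le> indicator (A i) x * cond (add_one_cost x F) k"
      by (simp add: cond_const[OF k])
  qed
  then show ?thesis
    using cond_add_mset_diff[OF i k F] cell_pos[OF i] by (metis diff_ge_0_iff_ge divide_nonneg_pos)
qed

text \<open>The difference formula is used twice: for \<open>F\<close> in cell \<open>i\<close>,
  and, at fixed \<open>x\<close>, for the add-one cost at \<open>x\<close> in cell \<open>j\<close>,
  whose increments are averages of second differences.\<close>

lemma cond_concave:
  assumes i: "i < m" and j: "j < m" and k: "set_mset k \<subseteq> {..<m}"
  shows "cond F (add_mset j (add_mset i k)) - cond F (add_mset j k) \<le> cond F (add_mset i k) - cond F k"
proof -
  have jk: "set_mset (add_mset j k) \<subseteq> {..<m}"
    using j k by simp
  have "(\<integral>x. indicator (A i) x * cond (add_one_cost x F) (add_mset j k) \<partial>M)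
      \<le> (\<integral>x. indicator (A i) x * cond (add_one_cost x F) k \<partial>M)"
  proof (rule integral_mono_AE[OF integrable_cell_cond_D[OF i jk] integrable_cell_cond_D[OF i k]],
      use conc AE_space in eventually_elim)
    fix x assume x: "AE y in M. AE \<mu> in Q. add_one_cost y (add_one_cost x F) \<mu> \<le> 0" "x \<in> space M"
    let ?D = "add_one_cost x F"
    have "0 \<le> (\<integral>y. - (indicator (A j) y * cond (add_one_cost y ?D) k) \<partial>M)"
    proof (rule integral_nonneg_AE, use x(1) AE_space in eventually_elim)
      fix y assume y: "AE \<mu> in Q. add_one_cost y ?D \<mu> \<le> 0" "y \<in> space M"
      have "cond (add_one_cost y ?D) k \<le> cond (\<lambda>_. 0) k"
        by (rule cond_mono[where c = "2 * (2 * c)", OF measurable_add_one_cost[OF D_measurable[OF x(2)] y(2)]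
              add_one_cost_bounded[OF D_bounded] _ _ y(1)])
          (use bound_nonneg[of F, OF F(2)] in auto)
      then show "0 \<le> - (indicator (A j) y * cond (add_one_cost y ?D) k)"
        by (simp add: cond_const[OF k] mult_nonneg_nonpos)
    qed
    then have "(\<integral>y. indicator (A j) y * cond (add_one_cost y ?D) k \<partial>M) \<le> 0"
      by simp
    then have "cond ?D (add_mset j k) - cond ?D k \<le> 0"
      using cond_add_mset_diff[OF j k D_measurable[OF x(2)] D_bounded] cell_pos[OF j]
      by (metis divide_nonpos_pos)
    then show "indicator (A i) x * cond ?D (add_mset j k) \<le> indicator (A i) x * cond ?D k"
      by (intro mult_left_mono) auto
  qed
  then have "cond F (add_mset i (add_mset j k)) - cond F (add_mset j k) \<le> cond F (add_mset i k) - cond F k"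
    using cond_add_mset_diff[OF i jk F] cond_add_mset_diff[OF i k F] cell_pos[OF i]
    by (simp only: divide_right_mono less_imp_le)
  then show ?thesis
    by (simp add: add_mset_commute)
qed

text \<open>Averages the difference formula over the law of the counts. Multiplying by the intensity
  clears the denominator, and the tower property removes the conditioning.\<close>

lemma integral_cond_diff:
  assumes i: "i < m"
  shows "measure M (A i) * (\<integral>k. cond F (add_mset i k) - cond F k \<partial>\<nu>) =
    (\<integral>x. indicator (A i) x * (\<integral>\<mu>. add_one_cost x F \<mu> \<partial>Q) \<partial>M)"
proof -
  have fin: "emeasure M (A i) < \<infinity>"
    using cell_finite[OF i] by simp
  \<comment> \<open>Integrating the add-one cost over the cell first gives a single bounded
    functional. By Fubini its conditional mean is the cell integral of the conditional means, so the
    tower property applies to \<open>G\<close>.\<close>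
  define G where "G \<mu> = (\<integral>x. indicator (A i) x * add_one_cost x F \<mu> \<partial>M)" for \<mu>
  have D_meas: "(\<lambda>(x, \<mu>). add_one_cost x F \<mu>) \<in> borel_measurable (M \<Otimes>\<^sub>M Q)"
    by (rule measurable_add_one_cost_case_prod[OF F(1)])
  have G_meas: "G \<in> borel_measurable Q"
  proof -
    have "(\<lambda>z. indicator (A i) (snd z) * (case (snd z, fst z) of (x, \<mu>) \<Rightarrow> add_one_cost x F \<mu>) :: real)
        \<in> borel_measurable (Q \<Otimes>\<^sub>M M)"
      using cell_sets[OF i]
      by (intro borel_measurable_times measurable_compose[OF measurable_snd borel_measurable_indicator]
          measurable_compose[OF measurable_Pair[OF measurable_snd measurable_fst] D_meas])
    then show ?thesis
      unfolding G_def[abs_def] by (intro borel_measurable_lebesgue_integral) (simp add: split_beta')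
  qed
  have G_bound: "\<bar>G \<mu>\<bar> \<le> measure M (A i) * (2 * c)" if \<mu>: "\<mu> \<in> point_measures M" for \<mu>
  proof -
    have D_x: "(\<lambda>x. add_one_cost x F \<mu>) \<in> borel_measurable M"
      using measurable_compose[OF measurable_Pair2'[of \<mu> Q M] D_meas] \<mu> by (simp add: space_Q)
    have "\<bar>G \<mu>\<bar> \<le> (\<integral>x. indicator (A i) x * (2 * c) \<partial>M)"
      unfolding G_def
    proof (rule integral_abs_bound[THEN order_trans], rule integral_mono)
      show "integrable M (\<lambda>x. \<bar>indicator (A i) x * add_one_cost x F \<mu>\<bar>)"
        by (intro integrable_abs integrable_bounded_on_finite[OF cell_sets[OF i] fin D_x D_bounded[OF \<mu>]])
      show "integrable M (\<lambda>x. indicator (A i) x * (2 * c))"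
        using cell_sets[OF i] fin by (intro integrable_mult_left integrable_real_indicator)
      show "\<bar>indicator (A i) x * add_one_cost x F \<mu>\<bar> \<le> indicator (A i) x * (2 * c)" for x
        using D_bounded[OF \<mu>, of x] by (simp add: indicator_def)
    qed
    then show ?thesis
      using cell_sets[OF i] fin by simp
  qed
  have "measure M (A i) * (\<integral>k. cond F (add_mset i k) - cond F k \<partial>\<nu>) =
      (\<integral>k. measure M (A i) * (cond F (add_mset i k) - cond F k) \<partial>\<nu>)"
    by simp
  also have "\<dots> = (\<integral>k. indicator UNIV k * cond G k \<partial>\<nu>)"
  proof (rule integral_cong_AE, goal_cases)
    case 3
    show ?case
      using AE_\<nu>
    proof eventually_elim
      fix k :: "nat multiset" assume k: "set_mset k \<subseteq> {..<m}"
      have "measure M (A i) * (cond F (add_mset i k) - cond F k) =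
          (\<integral>x. indicator (A i) x * cond (add_one_cost x F) k \<partial>M)"
        using cond_add_mset_diff[OF i k F] cell_pos[OF i] by simp
      also have "\<dots> = (\<integral>x. indicator (A i) x * (\<integral>\<mu>. indicator {k} (N \<mu>) * add_one_cost x F \<mu> \<partial>Q) \<partial>M) / measure \<nu> {k}"
        unfolding cond_def times_divide_eq_right by (rule integral_divide_zero)
      also have "\<dots> = (\<integral>\<mu>. (\<integral>x. indicator (A i) x * (indicator {k} (N \<mu>) * add_one_cost x F \<mu>) \<partial>M) \<partial>Q) / measure \<nu> {k}"
      proof (subst Fubini_bounded_on_finite[OF cell_sets[OF i] fin, where c = "2 * c"])
        have "(\<lambda>z. indicator {k} (N (snd z)) * (case z of (x, \<mu>) \<Rightarrow> add_one_cost x F \<mu>) :: real)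
            \<in> borel_measurable (M \<Otimes>\<^sub>M Q)"
          by (rule borel_measurable_times[OF measurable_compose[OF measurable_snd indicator_counts_measurable] D_meas])
        then show "(\<lambda>(x, \<mu>). indicator {k} (N \<mu>) * add_one_cost x F \<mu>) \<in> borel_measurable (M \<Otimes>\<^sub>M Q)"
          by (simp add: split_beta')
        show "\<bar>indicator {k} (N \<mu>) * add_one_cost x F \<mu>\<bar> \<le> 2 * c" if "\<mu> \<in> point_measures M" for x \<mu>
          using D_bounded[OF that, of x] by (simp add: indicator_def)
      qed simp
      also have "\<dots> = (\<integral>\<mu>. indicator {k} (N \<mu>) * G \<mu> \<partial>Q) / measure \<nu> {k}"
        unfolding G_def mult.left_commute[of "indicator (A i) _"] integral_mult_right_zero ..
      also have "\<dots> = indicator UNIV k * cond G k"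
        by (simp add: cond_def)
      finally show "measure M (A i) * (cond F (add_mset i k) - cond F k) = indicator UNIV k * cond G k" .
    qed
  qed simp_all
  also have "\<dots> = (\<integral>\<mu>. indicator UNIV (N \<mu>) * G \<mu> \<partial>Q)"
    by (rule integral_cond[OF G_meas G_bound])
  also have "\<dots> = (\<integral>\<mu>. G \<mu> \<partial>Q)"
    by simp
  also have "\<dots> = (\<integral>x. indicator (A i) x * (\<integral>\<mu>. add_one_cost x F \<mu> \<partial>Q) \<partial>M)"
    unfolding G_def by (rule Fubini_bounded_on_finite[OF cell_sets[OF i] fin D_meas D_bounded])
  finally show ?thesis .
qed

text \<open>The inequality for increasing concave functions is integrated over independent
  \<open>k\<close> in \<open>K\<close> and \<open>l\<close> outside \<open>K\<close>. Independence
  factors each term of the sum into the mean count \<open>\<lambda>(A_i)\<close> and a mean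
  increment, whose product is the cell integral from \<open>integral_cond_diff\<close>.\<close>

lemma covariance_grid_le:
  "(\<integral>\<mu>. indicator K (N \<mu>) * F \<mu> \<partial>Q) - (\<integral>\<mu>. F \<mu> \<partial>Q) * measure \<nu> K
    \<le> (\<Sum>i<m. \<integral>x. indicator (A i) x * (\<integral>\<mu>. add_one_cost x F \<mu> \<partial>Q) \<partial>M)"
proof -
  interpret \<nu>: prob_space \<nu>
    by (rule prob_space_\<nu>)
  let ?f = "cond F"
  define d where "d i l = ?f (add_mset i l) - ?f l" for i l
  have c: "0 \<le> c"
    by (rule bound_nonneg[of F, OF F(2)])
  have f_le: "\<bar>?f k\<bar> \<le> c" if "set_mset k \<subseteq> {..<m}" for k
    by (rule cond_abs_le[OF F that])
  have int_f: "integrable \<nu> (\<lambda>l. indicator L l * ?f l)" for L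
  proof (rule \<nu>.integrable_const_bound)
    show "AE l in \<nu>. norm (indicator L l * ?f l) \<le> c"
      using AE_\<nu> by eventually_elim (use f_le c in \<open>simp add: indicator_def\<close>)
  qed simp
  have int_ind: "integrable \<nu> (\<lambda>l. indicator L l * a)" for L and a :: real
    by (intro integrable_mult_left integrable_real_indicator) (simp_all add: \<nu>.emeasure_eq_measure)
  have int_d: "integrable \<nu> (d i)" if "i < m" for i
  proof (rule \<nu>.integrable_const_bound)
    show "AE l in \<nu>. norm (d i l) \<le> 2 * c"
      using AE_\<nu>
    proof eventually_elim
      fix l assume l: "set_mset l \<subseteq> {..<m}"
      then have "set_mset (add_mset i l) \<subseteq> {..<m}"
        using that by simp
      then show "norm (d i l) \<le> 2 * c"
        using f_le[OF l] f_le[of "add_mset i l"] unfolding d_def real_norm_def by linarith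
    qed
  qed simp
  have d_nonneg: "0 \<le> d i l" if "i < m" "set_mset l \<subseteq> {..<m}" for i l
    using cond_increasing[OF that] by (simp add: d_def)
  have conc': "?f k \<le> ?f l + (\<Sum>i<m. real (count k i) * d i l)"
    if "set_mset k \<subseteq> {..<m}" "set_mset l \<subseteq> {..<m}" for k l
    unfolding d_def using that by (intro multiset_increasing_concave_le) (auto intro!: cond_increasing cond_concave)
  define p where "p = measure \<nu> K"
  have p: "0 \<le> p" "p \<le> 1"
    by (simp_all add: p_def)
  define a where "a = (\<integral>l. indicator K l * ?f l \<partial>\<nu>)"
  define b where "b = (\<integral>l. indicator (- K) l * ?f l \<partial>\<nu>)"
  have compl: "measure \<nu> (- K) = 1 - p"
    using \<nu>.prob_compl[of K] by (simp add: p_def Compl_eq_Diff_UNIV)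
  \<comment> \<open>Here \<open>l\<close> is averaged over \<open>- K\<close> with \<open>k\<close>
    fixed. The increments are nonnegative, so their sum may be integrated over all
    \<open>l\<close>.\<close>
  have step: "?f k * (1 - p) \<le> b + (\<Sum>i<m. real (count k i) * (\<integral>l. d i l \<partial>\<nu>))"
    if k: "set_mset k \<subseteq> {..<m}" for k
  proof -
    have "?f k * (1 - p) = (\<integral>l. indicator (- K) l * ?f k \<partial>\<nu>)"
      using compl by simp
    also have "\<dots> \<le> (\<integral>l. indicator (- K) l * ?f l + (\<Sum>i<m. real (count k i) * d i l) \<partial>\<nu>)"
    proof (rule integral_mono_AE)
      show "AE l in \<nu>. indicator (- K) l * ?f k \<le> indicator (- K) l * ?f l + (\<Sum>i<m. real (count k i) * d i l)"
        using AE_\<nu>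
      proof eventually_elim
        fix l assume l: "set_mset l \<subseteq> {..<m}"
        have "0 \<le> (\<Sum>i<m. real (count k i) * d i l)"
          using l by (intro sum_nonneg mult_nonneg_nonneg d_nonneg) auto
        then show "indicator (- K) l * ?f k \<le> indicator (- K) l * ?f l + (\<Sum>i<m. real (count k i) * d i l)"
          using conc'[OF k l] by (simp add: indicator_def)
      qed
      show "integrable \<nu> (\<lambda>l. indicator (- K) l * ?f l + (\<Sum>i<m. real (count k i) * d i l))"
        by (intro Bochner_Integration.integrable_add int_f Bochner_Integration.integrable_sum
            integrable_mult_right int_d) simp
    qed (rule int_ind)
    also have "\<dots> = b + (\<integral>l. (\<Sum>i<m. real (count k i) * d i l) \<partial>\<nu>)"
      unfolding b_def by (intro Bochner_Integration.integral_add int_f Bochner_Integration.integrable_sum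
            integrable_mult_right int_d) simp
    also have "(\<integral>l. (\<Sum>i<m. real (count k i) * d i l) \<partial>\<nu>) = (\<Sum>i<m. \<integral>l. real (count k i) * d i l \<partial>\<nu>)"
      by (intro Bochner_Integration.integral_sum integrable_mult_right int_d) simp
    finally show ?thesis
      by simp
  qed
  have int_step: "integrable \<nu> (\<lambda>k. indicator K k * b + (\<Sum>i<m. real (count k i) * (\<integral>l. d i l \<partial>\<nu>)))"
    by (intro Bochner_Integration.integrable_add int_ind Bochner_Integration.integrable_sum
        integrable_mult_left integrable_count_\<nu>) simp
  \<comment> \<open>Now \<open>k\<close> is averaged over \<open>K\<close>; again the nonnegative
    sum is integrated without the restriction, which brings in the full mean counts.\<close>
  have "a * (1 - p) = (\<integral>k. indicator K k * ?f k * (1 - p) \<partial>\<nu>)"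
    by (simp add: a_def)
  also have "\<dots> \<le> (\<integral>k. indicator K k * b + (\<Sum>i<m. real (count k i) * (\<integral>l. d i l \<partial>\<nu>)) \<partial>\<nu>)"
  proof (rule integral_mono_AE[OF _ int_step])
    show "integrable \<nu> (\<lambda>k. indicator K k * ?f k * (1 - p))"
      by (intro integrable_mult_left int_f)
    show "AE k in \<nu>. indicator K k * ?f k * (1 - p)
        \<le> indicator K k * b + (\<Sum>i<m. real (count k i) * (\<integral>l. d i l \<partial>\<nu>))"
      using AE_\<nu>
    proof eventually_elim
      fix k assume k: "set_mset k \<subseteq> {..<m}"
      have "0 \<le> (\<integral>l. d i l \<partial>\<nu>)" if "i < m" for i
        using AE_\<nu> by (intro integral_nonneg_AE) (auto elim!: eventually_mono intro: d_nonneg[OF that])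
      then have "0 \<le> (\<Sum>i<m. real (count k i) * (\<integral>l. d i l \<partial>\<nu>))"
        by (intro sum_nonneg mult_nonneg_nonneg) auto
      then show "indicator K k * ?f k * (1 - p)
          \<le> indicator K k * b + (\<Sum>i<m. real (count k i) * (\<integral>l. d i l \<partial>\<nu>))"
        using step[OF k] by (simp add: indicator_def)
    qed
  qed
  also have "\<dots> = (\<integral>k. indicator K k * b \<partial>\<nu>) + (\<integral>k. (\<Sum>i<m. real (count k i) * (\<integral>l. d i l \<partial>\<nu>)) \<partial>\<nu>)"
    by (intro Bochner_Integration.integral_add int_ind Bochner_Integration.integrable_sum
        integrable_mult_left integrable_count_\<nu>) simp
  also have "(\<integral>k. (\<Sum>i<m. real (count k i) * (\<integral>l. d i l \<partial>\<nu>)) \<partial>\<nu>) =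
      (\<Sum>i<m. \<integral>k. real (count k i) * (\<integral>l. d i l \<partial>\<nu>) \<partial>\<nu>)"
    by (intro Bochner_Integration.integral_sum integrable_mult_left integrable_count_\<nu>) simp
  also have "\<dots> = (\<Sum>i<m. measure M (A i) * (\<integral>l. d i l \<partial>\<nu>))"
    by (intro sum.cong refl) (simp add: integrable_count_\<nu>)
  also have "(\<integral>k. indicator K k * b \<partial>\<nu>) = p * b"
    by (simp add: p_def)
  finally have "a * (1 - p) \<le> p * b + (\<Sum>i<m. measure M (A i) * (\<integral>l. d i l \<partial>\<nu>))" .
  moreover have "(\<Sum>i<m. measure M (A i) * (\<integral>l. d i l \<partial>\<nu>)) =
      (\<Sum>i<m. \<integral>x. indicator (A i) x * (\<integral>\<mu>. add_one_cost x F \<mu> \<partial>Q) \<partial>M)"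
    unfolding d_def by (intro sum.cong refl integral_cond_diff) simp
  moreover have "a = (\<integral>\<mu>. indicator K (N \<mu>) * F \<mu> \<partial>Q)"
    unfolding a_def by (rule integral_cond[OF F])
  moreover have "a + b = (\<integral>\<mu>. F \<mu> \<partial>Q)"
  proof -
    have "a + b = (\<integral>l. indicator K l * ?f l + indicator (- K) l * ?f l \<partial>\<nu>)"
      unfolding a_def b_def by (rule Bochner_Integration.integral_add[OF int_f int_f, symmetric])
    also have "\<dots> = (\<integral>l. indicator UNIV l * ?f l \<partial>\<nu>)"
      by (intro Bochner_Integration.integral_cong) (auto simp: indicator_def)
    also have "\<dots> = (\<integral>\<mu>. indicator UNIV (N \<mu>) * F \<mu> \<partial>Q)"
      by (rule integral_cond[OF F])
    finally show ?thesis
      by simp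
  qed
  \<comment> \<open>Uses \<open>a * (1 - p) - p * b = a - p * (a + b)\<close>, which is the
    covariance.\<close>
  ultimately show ?thesis
    by (simp add: p_def algebra_simps) (smt (verit) distrib_right mult.commute)
qed

end

end

section \<open>Covariance with an event\<close>

text \<open>For \<open>0 < a < 1\<close>, the inequality \<open>ln t \<le> t - 1\<close> at
  \<open>t = 1 / a\<close> gives \<open>a * (1 + ln (1 / a)) \<le> 1\<close>.\<close>

lemma \<Psi>_ge_self:
  assumes "0 \<le> a"
  shows "a \<le> \<Psi> a"
proof (cases "0 < a \<and> a < 1")
  case True
  have "ln (1 / a) \<le> 1 / a - 1"
    using True by (intro ln_le_minus_one) simp
  moreover have "0 \<le> ln (1 / a)"
    using True by simp
  moreover have pos: "0 < 1 + ln (1 / a)"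
    using \<open>0 \<le> ln (1 / a)\<close> by (rule add_pos_nonneg[OF zero_less_one])
  ultimately have "a * (1 + ln (1 / a)) \<le> a * (1 / a)"
    using True by (intro mult_left_mono) linarith+
  also have "\<dots> = 1"
    using True by simp
  finally have "a \<le> 1 / (1 + ln (1 / a))"
    by (simp only: pos_le_divide_eq[OF pos])
  also have "\<dots> \<le> 2 / (1 + ln (1 / a))"
    using \<open>0 \<le> ln (1 / a)\<close> by (intro divide_right_mono) auto
  finally show ?thesis
    using True by (simp add: \<Psi>_def)
qed (use assms in \<open>auto simp: \<Psi>_def\<close>)

section \<open>From finite-dimensional to arbitrary events\<close>

context poisson_law
begin

text \<open>Density of a generating algebra, by induction over the generated sigma-algebra. A
  countable union is cut off where the remainder has probability below \<open>e / 2\<close>, and the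
  finitely many remaining sets share the other half of the error.\<close>

lemma finite_dim_approximation:
  assumes "S \<in> sets Q" "0 < e"
  shows "\<exists>T\<in>finite_dim_events M. Q.prob ((S - T) \<union> (T - S)) < e"
proof -
  have "S \<in> sigma_sets (point_measures M) (finite_dim_events M)"
    using assms(1) by (simp add: sets_Q sets_point_measure_space_finite_dim[OF sigma_finite_measure_axioms])
  then show ?thesis
    using assms(2)
  proof (induction arbitrary: e)
    case (Basic S)
    then show ?case
      by (intro bexI[of _ S]) auto
  next
    case Empty
    then show ?case
      by (intro bexI[OF _ finite_dim_events_empty]) auto
  next
    case (Compl S)
    then obtain T where T: "T \<in> finite_dim_events M" "Q.prob ((S - T) \<union> (T - S)) < e"
      by blast
    have "((point_measures M - S) - (point_measures M - T)) \<union> ((point_measures M - T) - (point_measures M - S))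
        \<subseteq> (S - T) \<union> (T - S)"
      by blast
    moreover have "S \<in> sets Q"
      using Compl.hyps by (simp add: sets_Q sets_point_measure_space_finite_dim[OF sigma_finite_measure_axioms])
    moreover have "T \<in> sets Q"
      using sets_finite_dim_events[OF T(1)] by (simp add: sets_Q)
    ultimately have "Q.prob (((point_measures M - S) - (point_measures M - T)) \<union>
        ((point_measures M - T) - (point_measures M - S))) \<le> Q.prob ((S - T) \<union> (T - S))"
      by (intro Q.finite_measure_mono) auto
    with T show ?case
      by (intro bexI[OF _ finite_dim_events_Diff[OF T(1)]]) simp
  next
    case (Union S)
    have S: "S i \<in> sets Q" for i
      using Union.hyps by (simp add: sets_Q sets_point_measure_space_finite_dim[OF sigma_finite_measure_axioms])
    define U where "U n = (\<Union>i<n. S i)" for n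
    have U: "range U \<subseteq> sets Q" "(\<Union>n. U n) = (\<Union>i. S i)"
      using S by (auto simp: U_def)
    have "incseq U"
      by (rule incseq_SucI) (auto simp: U_def less_Suc_eq)
    have "(\<lambda>n. Q.prob (U n)) \<longlonglongrightarrow> Q.prob (\<Union>i. S i)"
      using Q.finite_Lim_measure_incseq[OF U(1) \<open>incseq U\<close>] U(2) by simp
    then have "\<forall>\<^sub>F n in sequentially. Q.prob (\<Union>i. S i) - e / 2 < Q.prob (U n)"
      using Union.prems by (intro order_tendstoD) auto
    then obtain n where n: "Q.prob (\<Union>i. S i) - e / 2 < Q.prob (U n)"
      by (auto simp: eventually_sequentially)
    \<comment> \<open>The denominator uses \<open>n + 1\<close> so that the tolerance stays positive
      for \<open>n = 0\<close>.\<close>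
    have "\<exists>T\<in>finite_dim_events M. Q.prob ((S i - T) \<union> (T - S i)) < e / (2 * (real n + 1))" for i
      using Union.prems by (intro Union.IH) simp
    then obtain T where T: "\<And>i. T i \<in> finite_dim_events M"
      "\<And>i. Q.prob ((S i - T i) \<union> (T i - S i)) < e / (2 * (real n + 1))"
      by metis
    have TQ: "T i \<in> sets Q" for i
      using sets_finite_dim_events[OF T(1)] by (simp add: sets_Q)
    have fd: "(\<Union>i<k. T i) \<in> finite_dim_events M" for k
    proof (induction k)
      case 0
      then show ?case
        by (simp add: finite_dim_events_empty)
    next
      case (Suc k)
      then show ?case
        by (simp add: lessThan_Suc finite_dim_events_Un T(1))
    qed
    let ?S = "\<Union>i. S i" and ?T = "\<Union>i<n. T i"
    have "Q.prob ((?S - ?T) \<union> (?T - ?S))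
        \<le> Q.prob ((?S - U n) \<union> (\<Union>i<n. (S i - T i) \<union> (T i - S i)))"
      using S TQ by (intro Q.finite_measure_mono) (auto simp: U_def)
    also have "\<dots> \<le> Q.prob (?S - U n) + Q.prob (\<Union>i<n. (S i - T i) \<union> (T i - S i))"
      using S TQ by (intro measure_Un_le) (auto simp: U_def)
    also have "Q.prob (?S - U n) = Q.prob ?S - Q.prob (U n)"
      using S by (intro Q.finite_measure_Diff) (auto simp: U_def)
    also have "Q.prob (\<Union>i<n. (S i - T i) \<union> (T i - S i)) \<le> (\<Sum>i<n. Q.prob ((S i - T i) \<union> (T i - S i)))"
      using S TQ by (intro Q.finite_measure_subadditive_finite) auto
    also have "\<dots> \<le> (\<Sum>i<n. e / (2 * (real n + 1)))"
      by (intro sum_mono less_imp_le T(2))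
    also have "\<dots> \<le> e / 2"
      using Union.prems by (simp add: field_simps)
    finally have "Q.prob ((?S - ?T) \<union> (?T - ?S)) < e"
      using n by linarith
    with fd show ?case
      by blast
  qed
qed

context
  fixes F :: "'a measure \<Rightarrow> real" and c :: real
  assumes F: "F \<in> borel_measurable Q" "\<And>\<mu>. \<mu> \<in> point_measures M \<Longrightarrow> \<bar>F \<mu>\<bar> \<le> c"
    and incr: "AE x in M. AE \<mu> in Q. 0 \<le> add_one_cost x F \<mu>"
    and conc: "AE x in M. AE y in M. AE \<mu> in Q. add_one_cost y (add_one_cost x F) \<mu> \<le> 0"
begin

text \<open>Removes the partition from the grid bound. The right-hand side may be infinite, hence
  the passage to nonnegative integrals.\<close>

lemma covariance_finite_dim_le:
  assumes S: "S \<in> finite_dim_events M"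
  shows "ennreal ((\<integral>\<mu>. indicator S \<mu> * F \<mu> \<partial>Q) - (\<integral>\<mu>. F \<mu> \<partial>Q) * Q.prob S)
    \<le> (\<integral>\<^sup>+x. ennreal (\<integral>\<mu>. \<bar>add_one_cost x F \<mu>\<bar> \<partial>Q) \<partial>M)"
proof -
  have SQ: "S \<in> sets Q"
    using sets_finite_dim_events[OF S] by (simp add: sets_Q)
  \<comment> \<open>Only the event needs to be resolved by the cells here, so the additional set is
    taken empty.\<close>
  have empty: "{} \<in> sets M" "emeasure M {} < \<infinity>"
    by simp_all
  obtain A :: "nat \<Rightarrow> 'a set" and m Z K where grid: "poisson_grid M Q A m Z"
    and K: "\<And>\<mu>. \<mu> \<in> poisson_grid.good M A m Z \<Longrightarrow> \<mu> \<in> S \<longleftrightarrow> counts A m \<mu> \<in> K"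
    using finite_dim_grid[OF S empty] by metis
  interpret poisson_grid M Q A m Z
    by (rule grid)
  define E where "E x = (\<integral>\<mu>. \<bar>add_one_cost x F \<mu>\<bar> \<partial>Q)" for x
  have E_nonneg: "0 \<le> E x" for x
    by (simp add: E_def)
  have D_meas: "(\<lambda>(x, \<mu>). add_one_cost x F \<mu>) \<in> borel_measurable (M \<Otimes>\<^sub>M Q)"
    by (rule measurable_add_one_cost_case_prod[OF F(1)])
  have ED_meas: "(\<lambda>x. \<integral>\<mu>. add_one_cost x F \<mu> \<partial>Q) \<in> borel_measurable M"
    by (rule Q.borel_measurable_lebesgue_integral[OF D_meas])
  have E_meas: "E \<in> borel_measurable M"
    unfolding E_def[abs_def] using borel_measurable_abs[OF D_meas]
    by (intro Q.borel_measurable_lebesgue_integral) (simp add: split_beta')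
  have E_le: "\<bar>E x\<bar> \<le> 2 * c" and ED_le: "(\<integral>\<mu>. add_one_cost x F \<mu> \<partial>Q) \<le> E x"
    "\<bar>\<integral>\<mu>. add_one_cost x F \<mu> \<partial>Q\<bar> \<le> 2 * c" if x: "x \<in> space M" for x
  proof -
    have D: "integrable Q (add_one_cost x F)"
      by (rule integrable_bounded[OF measurable_add_one_cost[OF F(1) x] add_one_cost_bounded[OF F(2)]])
    have "E x \<le> (\<integral>\<mu>. 2 * c \<partial>Q)"
      unfolding E_def
    proof (rule integral_mono)
      show "\<bar>add_one_cost x F \<mu>\<bar> \<le> 2 * c" if "\<mu> \<in> space Q" for \<mu>
        using that add_one_cost_bounded[OF F(2)] by (simp add: space_Q)
    qed (use D in auto)
    then show E: "\<bar>E x\<bar> \<le> 2 * c"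
      using E_nonneg[of x] by (simp add: Q.prob_space)
    have abs: "\<bar>\<integral>\<mu>. add_one_cost x F \<mu> \<partial>Q\<bar> \<le> E x"
      unfolding E_def by (rule integral_abs_bound)
    then show "(\<integral>\<mu>. add_one_cost x F \<mu> \<partial>Q) \<le> E x" "\<bar>\<integral>\<mu>. add_one_cost x F \<mu> \<partial>Q\<bar> \<le> 2 * c"
      using E by linarith+
  qed
  have fin: "emeasure M (A i) < \<infinity>" if "i < m" for i
    using cell_finite[OF that] by simp
  have int_E: "integrable M (\<lambda>x. indicator (A i) x * E x)" if "i < m" for i
    by (rule integrable_bounded_on_finite[OF cell_sets[OF that] fin[OF that] E_meas E_le])
  have "(\<integral>\<mu>. indicator S \<mu> * F \<mu> \<partial>Q) = (\<integral>\<mu>. indicator K (N \<mu>) * F \<mu> \<partial>Q)"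
  proof (rule integral_cong_AE)
    show "AE \<mu> in Q. indicator S \<mu> * F \<mu> = indicator K (N \<mu>) * F \<mu>"
      using AE_good by eventually_elim (simp add: K indicator_def)
  qed (use SQ F(1) indicator_counts_measurable in auto)
  moreover have "Q.prob S = measure \<nu> K"
    unfolding measure_\<nu>
  proof (rule Q.finite_measure_eq_AE[OF _ SQ])
    show "AE \<mu> in Q. \<mu> \<in> S \<longleftrightarrow> \<mu> \<in> N -` K \<inter> space Q"
      using AE_good AE_space by eventually_elim (simp add: K)
    show "N -` K \<inter> space Q \<in> sets Q"
      by (rule measurable_sets[OF measurable_counts]) simp
  qed
  moreover have "(\<Sum>i<m. \<integral>x. indicator (A i) x * (\<integral>\<mu>. add_one_cost x F \<mu> \<partial>Q) \<partial>M)
      \<le> (\<Sum>i<m. \<integral>x. indicator (A i) x * E x \<partial>M)"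
  proof (rule sum_mono)
    fix i assume "i \<in> {..<m}"
    then have i: "i < m"
      by simp
    show "(\<integral>x. indicator (A i) x * (\<integral>\<mu>. add_one_cost x F \<mu> \<partial>Q) \<partial>M) \<le> (\<integral>x. indicator (A i) x * E x \<partial>M)"
    proof (rule integral_mono[OF _ int_E[OF i]])
      show "integrable M (\<lambda>x. indicator (A i) x * (\<integral>\<mu>. add_one_cost x F \<mu> \<partial>Q))"
        by (rule integrable_bounded_on_finite[OF cell_sets[OF i] fin[OF i] ED_meas ED_le(2)])
      show "indicator (A i) x * (\<integral>\<mu>. add_one_cost x F \<mu> \<partial>Q) \<le> indicator (A i) x * E x"
        if "x \<in> space M" for x
        using ED_le(1)[OF that] by (intro mult_left_mono) auto
    qed
  qed
  ultimately have "(\<integral>\<mu>. indicator S \<mu> * F \<mu> \<partial>Q) - (\<integral>\<mu>. F \<mu> \<partial>Q) * Q.prob S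
      \<le> (\<Sum>i<m. \<integral>x. indicator (A i) x * E x \<partial>M)"
    using covariance_grid_le[OF F incr conc, of K] by simp
  then have "ennreal ((\<integral>\<mu>. indicator S \<mu> * F \<mu> \<partial>Q) - (\<integral>\<mu>. F \<mu> \<partial>Q) * Q.prob S)
      \<le> ennreal (\<Sum>i<m. \<integral>x. indicator (A i) x * E x \<partial>M)"
    by (rule ennreal_leI)
  also have "\<dots> = (\<Sum>i<m. ennreal (\<integral>x. indicator (A i) x * E x \<partial>M))"
    using E_nonneg by (intro sum_ennreal[symmetric] Bochner_Integration.integral_nonneg) simp
  also have "\<dots> = (\<Sum>i<m. \<integral>\<^sup>+x. ennreal (indicator (A i) x * E x) \<partial>M)"
    using E_nonneg by (intro sum.cong refl nn_integral_eq_integral[symmetric] int_E) auto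
  also have "\<dots> = (\<integral>\<^sup>+x. (\<Sum>i<m. ennreal (indicator (A i) x * E x)) \<partial>M)"
    using E_meas cell_sets by (intro nn_integral_sum[symmetric]) auto
  also have "\<dots> \<le> (\<integral>\<^sup>+x. ennreal (E x) \<partial>M)"
  proof (rule nn_integral_mono)
    fix x
    show "(\<Sum>i<m. ennreal (indicator (A i) x * E x)) \<le> ennreal (E x)"
    \<comment> \<open>Disjoint cells: at most one summand is nonzero at a given
      \<open>x\<close>.\<close>
    proof (cases "\<exists>j<m. x \<in> A j")
      case True
      then obtain j where j: "j < m" "x \<in> A j"
        by blast
      have "x \<in> A i \<longleftrightarrow> i = j" if "i < m" for i
        using disjoint_cells that j unfolding disjoint_family_on_def by blast
      then have "(\<Sum>i<m. ennreal (indicator (A i) x * E x)) = (\<Sum>i<m. if i = j then ennreal (E x) else 0)"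
        by (intro sum.cong) auto
      then show ?thesis
        using j by simp
    next
      case False
      then have "(\<Sum>i<m. ennreal (indicator (A i) x * E x)) = 0"
        by (intro sum.neutral) auto
      then show ?thesis
        by simp
    qed
  qed
  finally show ?thesis
    unfolding E_def .
qed

text \<open>Replacing \<open>S\<close> by a nearby \<open>T\<close> changes each of the two terms of
  the covariance by at most \<open>c\<close> times the probability of the symmetric difference,
  while the right-hand side does not involve the event.\<close>

lemma covariance_le:
  assumes S: "S \<in> sets Q"
  shows "ennreal ((\<integral>\<mu>. indicator S \<mu> * F \<mu> \<partial>Q) - (\<integral>\<mu>. F \<mu> \<partial>Q) * Q.prob S)
    \<le> (\<integral>\<^sup>+x. ennreal (\<integral>\<mu>. \<bar>add_one_cost x F \<mu>\<bar> \<partial>Q) \<partial>M)" (is "_ \<le> ?I")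
proof (cases "?I = \<infinity>")
  case False
  have c: "0 \<le> c"
    by (rule bound_nonneg[of F, OF F(2)])
  have int_F: "integrable Q F"
    by (rule integrable_bounded[OF F])
  have EF: "\<bar>\<integral>\<mu>. F \<mu> \<partial>Q\<bar> \<le> c"
  proof -
    have "(\<integral>\<mu>. \<bar>F \<mu>\<bar> \<partial>Q) \<le> (\<integral>\<mu>. c \<partial>Q)"
      using int_F F(2) by (intro integral_mono) (auto simp: space_Q)
    then show ?thesis
      using order_trans[OF integral_abs_bound[of Q F]] by (simp add: Q.prob_space)
  qed
  have int_ind: "integrable Q (\<lambda>\<mu>. indicator T \<mu> * F \<mu>)" if "T \<in> sets Q" for T
    using integrable_mult_indicator[OF that int_F] by simp
  have "(\<integral>\<mu>. indicator S \<mu> * F \<mu> \<partial>Q) - (\<integral>\<mu>. F \<mu> \<partial>Q) * Q.prob S \<le> enn2real ?I"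
  proof (rule field_le_epsilon)
    fix e :: real assume e: "0 < e"
    \<comment> \<open>The two errors add up to \<open>2 * c\<close> times this tolerance; the
      summand 1 keeps the denominator positive when \<open>c = 0\<close>.\<close>
    obtain T where T: "T \<in> finite_dim_events M"
      and close: "Q.prob ((S - T) \<union> (T - S)) < e / (2 * c + 1)"
      using finite_dim_approximation[OF S, of "e / (2 * c + 1)"] e c by auto
    have TQ: "T \<in> sets Q"
      using sets_finite_dim_events[OF T] by (simp add: sets_Q)
    let ?\<Delta> = "(S - T) \<union> (T - S)"
    have \<Delta>: "?\<Delta> \<in> sets Q"
      using S TQ by blast
    have "(\<integral>\<mu>. indicator S \<mu> * F \<mu> \<partial>Q) - (\<integral>\<mu>. indicator T \<mu> * F \<mu> \<partial>Q) =
        (\<integral>\<mu>. indicator S \<mu> * F \<mu> - indicator T \<mu> * F \<mu> \<partial>Q)"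
      using int_ind S TQ by simp
    also have "\<dots> \<le> (\<integral>\<mu>. c * indicator ?\<Delta> \<mu> \<partial>Q)"
    proof (rule integral_mono)
      show "indicator S \<mu> * F \<mu> - indicator T \<mu> * F \<mu> \<le> c * indicator ?\<Delta> \<mu>" if "\<mu> \<in> space Q" for \<mu>
        using F(2)[of \<mu>] that by (auto simp: space_Q indicator_def abs_le_iff)
      show "integrable Q (\<lambda>\<mu>. c * indicator ?\<Delta> \<mu>)"
        using \<Delta> by (intro integrable_mult_right integrable_real_indicator) (simp_all add: Q.emeasure_eq_measure)
    qed (use int_ind S TQ in auto)
    also have "\<dots> = c * Q.prob ?\<Delta>"
      using \<Delta> by simp
    finally have 1: "(\<integral>\<mu>. indicator S \<mu> * F \<mu> \<partial>Q) - (\<integral>\<mu>. indicator T \<mu> * F \<mu> \<partial>Q) \<le> c * Q.prob ?\<Delta>" .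
    have "Q.prob S \<le> Q.prob T + Q.prob ?\<Delta>" "Q.prob T \<le> Q.prob S + Q.prob ?\<Delta>"
      using S TQ \<Delta> Q.finite_measure_mono[of S "T \<union> ?\<Delta>"] Q.finite_measure_mono[of T "S \<union> ?\<Delta>"]
        measure_Un_le[of T Q ?\<Delta>] measure_Un_le[of S Q ?\<Delta>] by fastforce+
    then have "\<bar>Q.prob T - Q.prob S\<bar> \<le> Q.prob ?\<Delta>"
      by linarith
    then have "\<bar>(\<integral>\<mu>. F \<mu> \<partial>Q) * (Q.prob T - Q.prob S)\<bar> \<le> c * Q.prob ?\<Delta>"
      unfolding abs_mult using EF c by (intro mult_mono) auto
    then have 2: "(\<integral>\<mu>. F \<mu> \<partial>Q) * Q.prob T - (\<integral>\<mu>. F \<mu> \<partial>Q) * Q.prob S \<le> c * Q.prob ?\<Delta>"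
      by (simp add: right_diff_distrib)
    have "(\<integral>\<mu>. indicator T \<mu> * F \<mu> \<partial>Q) - (\<integral>\<mu>. F \<mu> \<partial>Q) * Q.prob T \<le> enn2real ?I"
    proof (rule ccontr)
      let ?v = "(\<integral>\<mu>. indicator T \<mu> * F \<mu> \<partial>Q) - (\<integral>\<mu>. F \<mu> \<partial>Q) * Q.prob T"
      assume "\<not> ?v \<le> enn2real ?I"
      then have less: "enn2real ?I < ?v"
        by (simp only: not_le)
      have "ennreal (enn2real ?I) < ennreal ?v"
        by (rule ennreal_lessI[OF le_less_trans[OF enn2real_nonneg less] less])
      moreover have "ennreal (enn2real ?I) = ?I"
        using False by (intro ennreal_enn2real) (simp add: top.not_eq_extremum)
      ultimately show False
        using covariance_finite_dim_le[OF T] by simp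
    qed
    moreover have "2 * c * Q.prob ?\<Delta> \<le> e"
    proof -
      have "2 * c * Q.prob ?\<Delta> \<le> (2 * c + 1) * (e / (2 * c + 1))"
        using close c by (intro mult_mono) auto
      then show ?thesis
        using c by simp
    qed
    ultimately show "(\<integral>\<mu>. indicator S \<mu> * F \<mu> \<partial>Q) - (\<integral>\<mu>. F \<mu> \<partial>Q) * Q.prob S \<le> enn2real ?I + e"
      using 1 2 by linarith
  qed
  then have "ennreal ((\<integral>\<mu>. indicator S \<mu> * F \<mu> \<partial>Q) - (\<integral>\<mu>. F \<mu> \<partial>Q) * Q.prob S) \<le> ennreal (enn2real ?I)"
    by (rule ennreal_leI)
  then show ?thesis
    using False by (simp add: ennreal_enn2real_if)
qed simp

lemma variance_le:
  "ennreal (Q.variance F) \<le> ennreal (4 * c) * (\<integral>\<^sup>+x. ennreal (\<integral>\<mu>. \<bar>add_one_cost x F \<mu>\<bar> \<partial>Q) \<partial>M)"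
proof -
  have c: "0 \<le> c"
    by (rule bound_nonneg[of F, OF F(2)])
  have int_F: "integrable Q F"
    by (rule integrable_bounded[OF F])
  define e where "e = (\<integral>\<mu>. F \<mu> \<partial>Q)"
  have e: "\<bar>e\<bar> \<le> c"
  proof -
    have "(\<integral>\<mu>. \<bar>F \<mu>\<bar> \<partial>Q) \<le> (\<integral>\<mu>. c \<partial>Q)"
      using int_F F(2) by (intro integral_mono) (auto simp: space_Q)
    then show ?thesis
      using order_trans[OF integral_abs_bound[of Q F]] by (simp add: Q.prob_space e_def)
  qed
  define S where "S = {\<mu> \<in> space Q. e < F \<mu>}"
  have S: "S \<in> sets Q"
    unfolding S_def using F(1) by measurable
  have int_S: "integrable Q (\<lambda>\<mu>. indicator S \<mu> * F \<mu>)" "integrable Q (\<lambda>\<mu>. indicator S \<mu> * e)"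
    using integrable_mult_indicator[OF S int_F] S
    by (auto intro!: integrable_mult_left integrable_real_indicator simp: Q.emeasure_eq_measure)
  define cov where "cov = (\<integral>\<mu>. indicator S \<mu> * F \<mu> \<partial>Q) - e * Q.prob S"
  \<comment> \<open>Both \<open>F\<close> and its mean lie within \<open>c\<close> of 0, so
    \<open>(F - e)^2 \<le> 2 c |F - e|\<close>. The absolute value is written as
    \<open>2 * 1_S (F - e) - (F - e)\<close>, whose last term has mean zero; the factors
    \<open>2 c\<close> and \<open>2\<close> make up the constant \<open>4 c\<close>.\<close>
  have "Q.variance F \<le> (\<integral>\<mu>. 2 * c * (2 * (indicator S \<mu> * F \<mu> - indicator S \<mu> * e) - (F \<mu> - e)) \<partial>Q)"
    unfolding e_def[symmetric]
  proof (rule integral_mono)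
    show "integrable Q (\<lambda>\<mu>. (F \<mu> - e)\<^sup>2)"
    proof (rule integrable_bounded[where c = "(2 * c)\<^sup>2"])
      show "\<bar>(F \<mu> - e)\<^sup>2\<bar> \<le> (2 * c)\<^sup>2" if "\<mu> \<in> point_measures M" for \<mu>
      proof -
        have "\<bar>F \<mu> - e\<bar> \<le> \<bar>2 * c\<bar>"
          using F(2)[OF that] e c by linarith
        then have "(F \<mu> - e)\<^sup>2 \<le> (2 * c)\<^sup>2"
          by (rule abs_le_square_iff[THEN iffD1])
        then show ?thesis
          by (simp only: abs_power2)
      qed
    qed (use F(1) in measurable)
    show "integrable Q (\<lambda>\<mu>. 2 * c * (2 * (indicator S \<mu> * F \<mu> - indicator S \<mu> * e) - (F \<mu> - e)))"
      using int_F int_S by (intro integrable_mult_right Bochner_Integration.integrable_diff) auto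
    show "(F \<mu> - e)\<^sup>2 \<le> 2 * c * (2 * (indicator S \<mu> * F \<mu> - indicator S \<mu> * e) - (F \<mu> - e))"
      if "\<mu> \<in> space Q" for \<mu>
    proof -
      have "2 * (indicator S \<mu> * F \<mu> - indicator S \<mu> * e) - (F \<mu> - e) = \<bar>F \<mu> - e\<bar>"
        using that by (simp add: S_def indicator_def)
      moreover have "\<bar>F \<mu> - e\<bar> * \<bar>F \<mu> - e\<bar> \<le> 2 * c * \<bar>F \<mu> - e\<bar>"
        using F(2)[of \<mu>] that e by (intro mult_right_mono) (auto simp: space_Q)
      ultimately show ?thesis
        by (simp add: power2_eq_square abs_mult_self_eq)
    qed
  qed
  also have "\<dots> = 2 * c * (2 * cov - (e - e))"
    using int_F int_S S by (simp add: cov_def e_def[symmetric] Q.prob_space)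
  finally have "Q.variance F \<le> 4 * c * cov"
    by simp
  then have "ennreal (Q.variance F) \<le> ennreal (4 * c) * ennreal cov"
    using c by (simp add: ennreal_mult'[symmetric] ennreal_leI)
  also have "\<dots> \<le> ennreal (4 * c) * (\<integral>\<^sup>+x. ennreal (\<integral>\<mu>. \<bar>add_one_cost x F \<mu>\<bar> \<partial>Q) \<partial>M)"
    unfolding cov_def e_def by (intro mult_left_mono covariance_le S) simp
  finally show ?thesis .
qed

end

end

section \<open>The variance bound\<close>

text \<open>Permits passing from the given probability space to the law of the process. Independence
  is transferred through its characterisation by the joint distribution being the product of the
  marginals, as both are image measures.\<close>

lemma poisson_process_distr:
  assumes P: "prob_space P" and \<eta>: "poisson_process P M \<eta>"
  shows "poisson_process (distr P (point_measure_space M) \<eta>) M (\<lambda>\<mu>. \<mu>)" (is "poisson_process ?Q M _")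
proof -
  interpret P: prob_space P by fact
  have meas: "\<eta> \<in> P \<rightarrow>\<^sub>M point_measure_space M"
    using \<eta> by (simp add: poisson_process_def)
  interpret Q: prob_space ?Q
    by (rule P.prob_space_distr[OF meas])
  have e_meas: "(\<lambda>\<mu>. emeasure \<mu> B) \<in> borel_measurable ?Q" if "B \<in> sets M" for B
    using measurable_emeasure_point_measure[OF that] by simp
  have var: "poisson_variable ?Q (emeasure M B) (\<lambda>\<mu>. emeasure \<mu> B)" if B: "B \<in> sets M" for B
  proof -
    have "poisson_variable P (emeasure M B) (\<lambda>\<omega>. emeasure (\<eta> \<omega>) B)"
      using \<eta> B by (simp add: poisson_process_def)
    moreover have ev: "{\<mu> \<in> space (point_measure_space M). emeasure \<mu> B = r} \<in> sets (point_measure_space M)" for r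
      using measurable_sets[OF measurable_emeasure_point_measure[OF B], of "{r}"]
      by (simp add: vimage_def Int_def conj_commute)
    moreover have "measure ?Q {\<mu> \<in> space ?Q. emeasure \<mu> B = of_nat k} =
        measure P {\<omega> \<in> space P. emeasure (\<eta> \<omega>) B = of_nat k}" for k
      using measure_distr[OF meas ev[of "of_nat k"]] measurable_space[OF meas]
      by (simp add: vimage_def Int_def conj_commute cong: conj_cong)
    ultimately show ?thesis
      using e_meas[OF B] unfolding poisson_variable_def
      by (auto simp: AE_distr_iff[OF meas] split: if_splits)
  qed
  have indep: "Q.indep_vars (\<lambda>_. borel) (\<lambda>i \<mu>. emeasure \<mu> (B i)) {..<m}"
    if B: "\<forall>i<m. B i \<in> sets M" "disjoint_family_on B {..<m}" for m :: nat and B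
  \<comment> \<open>The product characterisation of independence requires a nonempty index
    set.\<close>
  proof (cases "m = 0")
    case True
    then show ?thesis
      by (simp add: Q.indep_vars_def Q.indep_sets_def)
  next
    case False
    have "P.indep_vars (\<lambda>_. borel) (\<lambda>i \<omega>. emeasure (\<eta> \<omega>) (B i)) {..<m}"
      using \<eta> B unfolding poisson_process_def by blast
    then have "distr P (\<Pi>\<^sub>M i\<in>{..<m}. borel) (\<lambda>\<omega>. \<lambda>i\<in>{..<m}. emeasure (\<eta> \<omega>) (B i)) =
        (\<Pi>\<^sub>M i\<in>{..<m}. distr P borel (\<lambda>\<omega>. emeasure (\<eta> \<omega>) (B i)))"
      using False B meas
      by (subst (asm) P.indep_vars_iff_distr_eq_PiM')
        (auto intro: measurable_compose[OF meas measurable_emeasure_point_measure])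
    moreover have "distr ?Q (\<Pi>\<^sub>M i\<in>{..<m}. borel) (\<lambda>\<mu>. \<lambda>i\<in>{..<m}. emeasure \<mu> (B i)) =
        distr P (\<Pi>\<^sub>M i\<in>{..<m}. borel) (\<lambda>\<omega>. \<lambda>i\<in>{..<m}. emeasure (\<eta> \<omega>) (B i))"
      using B by (subst distr_distr[OF _ meas])
        (auto simp: comp_def intro!: measurable_restrict measurable_emeasure_point_measure)
    moreover have "(\<Pi>\<^sub>M i\<in>{..<m}. distr ?Q borel (\<lambda>\<mu>. emeasure \<mu> (B i))) =
        (\<Pi>\<^sub>M i\<in>{..<m}. distr P borel (\<lambda>\<omega>. emeasure (\<eta> \<omega>) (B i)))"
      using B by (intro PiM_cong refl) (auto simp: distr_distr[OF measurable_emeasure_point_measure meas] comp_def)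
    ultimately show ?thesis
      using False B e_meas by (subst Q.indep_vars_iff_distr_eq_PiM') auto
  qed
  show ?thesis
    unfolding poisson_process_def using var indep by (auto intro: measurable_ident_sets)
qed

section \<open>From everywhere bounded to essentially bounded functionals\<close>

context poisson_law
begin

text \<open>Truncating \<open>F\<close> at \<open>c\<close> and \<open>- c\<close> changes it only
  on a null set. The add-one costs, however, evaluate it at configurations with added points, and
  that these also avoid the null set is the content of \<open>AE_add_point\<close>.\<close>

lemma variance_le_AE_bounded:
  fixes F :: "'a measure \<Rightarrow> real"
  assumes F: "F \<in> borel_measurable Q" "AE \<mu> in Q. \<bar>F \<mu>\<bar> \<le> c" "0 \<le> c"
    and incr: "AE x in M. AE \<mu> in Q. 0 \<le> add_one_cost x F \<mu>"
    and conc: "AE x in M. AE y in M. AE \<mu> in Q. add_one_cost y (add_one_cost x F) \<mu> \<le> 0"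
  shows "ennreal (Q.variance F) \<le> ennreal (4 * c) * (\<integral>\<^sup>+x. ennreal (\<integral>\<mu>. \<bar>add_one_cost x F \<mu>\<bar> \<partial>Q) \<partial>M)"
proof -
  define G where "G \<mu> = max (- c) (min c (F \<mu>))" for \<mu>
  have G: "G \<in> borel_measurable Q" "\<And>\<mu>. \<bar>G \<mu>\<bar> \<le> c"
    unfolding G_def[abs_def] using F(1,3) by (auto simp: max_def min_def)
  define S where "S = {\<mu> \<in> space Q. G \<mu> = F \<mu>}"
  have S: "S \<in> sets Q"
    unfolding S_def using F(1) G(1) by measurable
  have AE_S: "AE \<mu> in Q. \<mu> \<in> S"
    using F(2) AE_space by eventually_elim (auto simp: S_def G_def max_def min_def)
  have AE_S1: "AE x in M. AE \<mu> in Q. add_point \<mu> x \<in> S"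
    by (rule AE_add_point[OF S AE_S])
  \<comment> \<open>Second differences see two added points, so null sets are transported twice: the
    configurations that land in \<open>S\<close> after adding \<open>x\<close> form an event of full
    measure, to which \<open>AE_add_point\<close> applies again.\<close>
  have AE_S2: "AE x in M. AE y in M. AE \<mu> in Q. add_point (add_point \<mu> y) x \<in> S"
    using AE_S1 AE_space
  proof eventually_elim
    fix x assume x: "AE \<mu> in Q. add_point \<mu> x \<in> S" "x \<in> space M"
    let ?T = "{\<mu> \<in> space Q. add_point \<mu> x \<in> S}"
    have "(\<lambda>\<mu>. add_point \<mu> x) \<in> Q \<rightarrow>\<^sub>M Q"
      using measurable_compose[OF measurable_Pair1'[OF x(2)] measurable_add_point_Q] by simp
    from measurable_sets[OF this S] have T: "?T \<in> sets Q"
      by (simp add: vimage_def Int_def conj_commute)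
    have "AE \<mu> in Q. \<mu> \<in> ?T"
      using x(1) AE_space by eventually_elim simp
    from AE_add_point[OF T this] show "AE y in M. AE \<mu> in Q. add_point (add_point \<mu> y) x \<in> S"
      by simp
  qed
  have D: "AE x in M. AE \<mu> in Q. add_one_cost x G \<mu> = add_one_cost x F \<mu>"
    using AE_S1
  proof eventually_elim
    fix x assume "AE \<mu> in Q. add_point \<mu> x \<in> S"
    then show "AE \<mu> in Q. add_one_cost x G \<mu> = add_one_cost x F \<mu>"
      using AE_S by eventually_elim (simp add: add_one_cost_def S_def)
  qed
  have incr': "AE x in M. AE \<mu> in Q. 0 \<le> add_one_cost x G \<mu>"
    using incr D
  proof eventually_elim
    fix x assume "AE \<mu> in Q. 0 \<le> add_one_cost x F \<mu>" "AE \<mu> in Q. add_one_cost x G \<mu> = add_one_cost x F \<mu>"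
    then show "AE \<mu> in Q. 0 \<le> add_one_cost x G \<mu>"
      by eventually_elim simp
  qed
  have conc': "AE x in M. AE y in M. AE \<mu> in Q. add_one_cost y (add_one_cost x G) \<mu> \<le> 0"
    using conc D AE_S2
  proof eventually_elim
    fix x assume x: "AE y in M. AE \<mu> in Q. add_one_cost y (add_one_cost x F) \<mu> \<le> 0"
      "AE \<mu> in Q. add_one_cost x G \<mu> = add_one_cost x F \<mu>"
      "AE y in M. AE \<mu> in Q. add_point (add_point \<mu> y) x \<in> S"
    show "AE y in M. AE \<mu> in Q. add_one_cost y (add_one_cost x G) \<mu> \<le> 0"
      using x(1,3) AE_S1
    proof eventually_elim
      fix y assume y: "AE \<mu> in Q. add_one_cost y (add_one_cost x F) \<mu> \<le> 0"
        "AE \<mu> in Q. add_point (add_point \<mu> y) x \<in> S" "AE \<mu> in Q. add_point \<mu> y \<in> S"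
      show "AE \<mu> in Q. add_one_cost y (add_one_cost x G) \<mu> \<le> 0"
        using y x(2)
      proof eventually_elim
        fix \<mu> assume "add_one_cost y (add_one_cost x F) \<mu> \<le> 0" "add_point (add_point \<mu> y) x \<in> S"
          "add_point \<mu> y \<in> S" and eq: "add_one_cost x G \<mu> = add_one_cost x F \<mu>"
        then show "add_one_cost y (add_one_cost x G) \<mu> \<le> 0"
          unfolding add_one_cost_def[of y] eq by (simp add: add_one_cost_def S_def)
      qed
    qed
  qed
  have "(\<integral>\<mu>. F \<mu> \<partial>Q) = (\<integral>\<mu>. G \<mu> \<partial>Q)"
    using AE_S by (intro integral_cong_AE F(1) G(1)) (auto elim!: eventually_mono simp: S_def)
  moreover have "(\<integral>\<mu>. (F \<mu> - e)\<^sup>2 \<partial>Q) = (\<integral>\<mu>. (G \<mu> - e)\<^sup>2 \<partial>Q)" for e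
    using AE_S F(1) G(1) by (intro integral_cong_AE) (auto elim!: eventually_mono simp: S_def)
  ultimately have "Q.variance F = Q.variance G"
    by simp
  moreover have "(\<integral>\<^sup>+x. ennreal (\<integral>\<mu>. \<bar>add_one_cost x F \<mu>\<bar> \<partial>Q) \<partial>M) =
      (\<integral>\<^sup>+x. ennreal (\<integral>\<mu>. \<bar>add_one_cost x G \<mu>\<bar> \<partial>Q) \<partial>M)"
  proof (rule nn_integral_cong_AE, use D AE_space in eventually_elim)
    fix x assume x: "AE \<mu> in Q. add_one_cost x G \<mu> = add_one_cost x F \<mu>" "x \<in> space M"
    have "(\<integral>\<mu>. \<bar>add_one_cost x F \<mu>\<bar> \<partial>Q) = (\<integral>\<mu>. \<bar>add_one_cost x G \<mu>\<bar> \<partial>Q)"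
    proof (rule integral_cong_AE)
      show "AE \<mu> in Q. \<bar>add_one_cost x F \<mu>\<bar> = \<bar>add_one_cost x G \<mu>\<bar>"
        using x(1) by eventually_elim simp
    qed (intro borel_measurable_abs measurable_add_one_cost[OF F(1) x(2)] measurable_add_one_cost[OF G(1) x(2)])+
    then show "ennreal (\<integral>\<mu>. \<bar>add_one_cost x F \<mu>\<bar> \<partial>Q) = ennreal (\<integral>\<mu>. \<bar>add_one_cost x G \<mu>\<bar> \<partial>Q)"
      by simp
  qed
  ultimately show ?thesis
    using variance_le[OF G incr' conc'] by simp
qed

end

lemma poisson_variance_le:
  fixes F :: "'a measure \<Rightarrow> real"
  assumes P: "prob_space P" and M: "sigma_finite_measure M" and \<eta>: "poisson_process P M \<eta>"
    and F: "F \<in> borel_measurable (point_measure_space M)"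
    and bound: "AE \<omega> in P. \<bar>F (\<eta> \<omega>)\<bar> \<le> c" "0 \<le> c"
    and incr: "\<And>x. x \<in> space M \<Longrightarrow> AE \<omega> in P. 0 \<le> add_one_cost x F (\<eta> \<omega>)"
    and conc: "\<And>x y. x \<in> space M \<Longrightarrow> y \<in> space M \<Longrightarrow> AE \<omega> in P. add_one_cost y (add_one_cost x F) (\<eta> \<omega>) \<le> 0"
  shows "ennreal (prob_space.variance P (\<lambda>\<omega>. F (\<eta> \<omega>)))
    \<le> ennreal (4 * c) * (\<integral>\<^sup>+x. ennreal (prob_space.expectation P (\<lambda>\<omega>. \<bar>add_one_cost x F (\<eta> \<omega>)\<bar>)) \<partial>M)"
proof -
  interpret P: prob_space P by fact
  interpret sigma_finite_measure M by fact
  let ?Q = "distr P (point_measure_space M) \<eta>"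
  have meas: "\<eta> \<in> P \<rightarrow>\<^sub>M point_measure_space M"
    using \<eta> by (simp add: poisson_process_def)
  interpret Q: prob_space ?Q
    by (rule P.prob_space_distr[OF meas])
  interpret poisson_law M ?Q
    by unfold_locales (simp_all add: poisson_process_distr[OF P \<eta>])
  have FQ: "F \<in> borel_measurable ?Q"
    using F by simp
  have D: "add_one_cost x F \<in> borel_measurable (point_measure_space M)" if "x \<in> space M" for x
    using measurable_add_one_cost[OF FQ that] by simp
  have DD: "add_one_cost y (add_one_cost x F) \<in> borel_measurable (point_measure_space M)"
    if "x \<in> space M" "y \<in> space M" for x y
    using measurable_add_one_cost[of "add_one_cost x F" y] D[OF that(1)] that(2) by simp
  \<comment> \<open>A Borel condition on \<open>G\<close> holds almost surely under the law as soon
    as it holds along the process; this carries over the bound and both sign conditions.\<close>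
  have AE_Q: "AE \<mu> in ?Q. R (G \<mu>)"
    if "G \<in> borel_measurable (point_measure_space M)" "{r. R r} \<in> sets borel" "AE \<omega> in P. R (G (\<eta> \<omega>))"
    for G :: "'a measure \<Rightarrow> real" and R
    using measurable_sets[OF that(1,2)] that(3)
    by (subst AE_distr_iff[OF meas]) (simp_all add: vimage_def Int_def conj_commute)
  have "ennreal (Q.variance F)
    \<le> ennreal (4 * c) * (\<integral>\<^sup>+x. ennreal (\<integral>\<mu>. \<bar>add_one_cost x F \<mu>\<bar> \<partial>?Q) \<partial>M)"
  proof (rule variance_le_AE_bounded[OF FQ _ bound(2)])
    show "AE \<mu> in ?Q. \<bar>F \<mu>\<bar> \<le> c"
      by (rule AE_Q[of F "\<lambda>r. \<bar>r\<bar> \<le> c", OF F _ bound(1)]) measurable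
    show "AE x in M. AE \<mu> in ?Q. 0 \<le> add_one_cost x F \<mu>"
      using AE_space
    proof eventually_elim
      fix x assume x: "x \<in> space M"
      show "AE \<mu> in ?Q. 0 \<le> add_one_cost x F \<mu>"
        by (rule AE_Q[of _ "\<lambda>r. 0 \<le> r", OF D[OF x] _ incr[OF x]]) measurable
    qed
    show "AE x in M. AE y in M. AE \<mu> in ?Q. add_one_cost y (add_one_cost x F) \<mu> \<le> 0"
      using AE_space
    proof eventually_elim
      fix x assume x: "x \<in> space M"
      show "AE y in M. AE \<mu> in ?Q. add_one_cost y (add_one_cost x F) \<mu> \<le> 0"
        using AE_space
      proof eventually_elim
        fix y assume y: "y \<in> space M"
        show "AE \<mu> in ?Q. add_one_cost y (add_one_cost x F) \<mu> \<le> 0"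
          by (rule AE_Q[of _ "\<lambda>r. r \<le> 0", OF DD[OF x y] _ conc[OF x y]]) measurable
      qed
    qed
  qed
  moreover have "Q.variance F = P.variance (\<lambda>\<omega>. F (\<eta> \<omega>))"
    using F by (simp add: integral_distr[OF meas])
  moreover have "(\<integral>\<^sup>+x. ennreal (\<integral>\<mu>. \<bar>add_one_cost x F \<mu>\<bar> \<partial>?Q) \<partial>M) =
      (\<integral>\<^sup>+x. ennreal (P.expectation (\<lambda>\<omega>. \<bar>add_one_cost x F (\<eta> \<omega>)\<bar>)) \<partial>M)"
    by (intro nn_integral_cong arg_cong[where f = ennreal] integral_distr[OF meas] borel_measurable_abs D)
  ultimately show ?thesis
    by simp
qed

text \<open>The essential supremum bounds its function almost everywhere. The a priori bound
  \<open>C\<close> excludes the value \<infinity>, which \<open>real_of_ereal\<close> would turn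
  into 0.\<close>

lemma Linf_norm_AE_bound:
  assumes P: "prob_space P" and X: "X \<in> borel_measurable P" and bound: "AE \<omega> in P. \<bar>X \<omega>\<bar> \<le> C"
  shows "AE \<omega> in P. \<bar>X \<omega>\<bar> \<le> Linf_norm P X" and "0 \<le> Linf_norm P X"
proof -
  interpret P: prob_space P by fact
  let ?s = "esssup P (\<lambda>\<omega>. ereal \<bar>X \<omega>\<bar>)"
  have AE: "AE \<omega> in P. ereal \<bar>X \<omega>\<bar> \<le> ?s"
    by (rule esssup_AE)
  then have "AE \<omega> in P. 0 \<le> ?s"
    by eventually_elim (rule order_trans[rotated], auto)
  then have nonneg: "0 \<le> ?s"
    by simp
  have "?s \<le> ereal C"
    using X bound by (intro esssup_I) auto
  with nonneg obtain r where r: "?s = ereal r" "0 \<le> r"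
    by (cases ?s) auto
  then have "Linf_norm P X = r"
    by (simp add: Linf_norm_def)
  with AE r show "AE \<omega> in P. \<bar>X \<omega>\<bar> \<le> Linf_norm P X" "0 \<le> Linf_norm P X"
    by simp_all
qed

text \<open>Above 1 the exponent is 1. On \<open>(0, 1]\<close> a power with exponent at most 1 only
  enlarges the base, and \<open>2 / (exp 1 + 1) \<le> 1\<close> because
  \<open>exp 1 \<ge> 2\<close>. At base 0 both sides vanish.\<close>

lemma le_powr_\<alpha>_exponent:
  assumes "0 \<le> Linf_norm P X"
  shows "2 * Linf_norm P X \<le> (2 * Linf_norm P X) powr \<alpha>_exponent P X"
proof (cases "Linf_norm P X = 0 \<or> 2 * Linf_norm P X > 1")
  case False
  have "0 \<le> 2 / (exp 1 + 1 :: real)"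
    by (intro divide_nonneg_nonneg add_nonneg_nonneg) auto
  moreover have "2 / (exp 1 + 1) \<le> (1 :: real)"
    using exp_ge_add_one_self[of "1 :: real"] by (simp add: divide_le_eq)
  ultimately have "(2 * Linf_norm P X) powr 1 \<le> (2 * Linf_norm P X) powr (2 / (exp 1 + 1))"
    using False assms by (intro powr_mono') auto
  then show ?thesis
    using False assms by (simp add: \<alpha>_exponent_def)
qed (auto simp: \<alpha>_exponent_def)

theorem theorem1p7:
  fixes P :: "'w measure" and M :: "'a measure"
    and \<eta> :: "'w \<Rightarrow> 'a measure" and F :: "'a measure \<Rightarrow> real"
  assumes "prob_space P"
    and "sigma_finite_measure M"
    and "poisson_process P M \<eta>"
    and "F \<in> borel_measurable (point_measure_space M)"
    and "\<exists>C. AE \<omega> in P. \<bar>F (\<eta> \<omega>)\<bar> \<le> C"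
    and "(\<forall>x\<in>space M. \<forall>y\<in>space M.
            (AE \<omega> in P. add_one_cost x F (\<eta> \<omega>) \<ge> 0) \<and>
            (AE \<omega> in P. add_one_cost x (add_one_cost y F) (\<eta> \<omega>) \<le> 0)) \<or>
         (\<forall>x\<in>space M. \<forall>y\<in>space M.
            (AE \<omega> in P. add_one_cost x F (\<eta> \<omega>) \<le> 0) \<and>
            (AE \<omega> in P. add_one_cost x (add_one_cost y F) (\<eta> \<omega>) \<ge> 0))"
  shows "ennreal (prob_space.variance P (\<lambda>\<omega>. F (\<eta> \<omega>)))
    \<le> ennreal (11 * (2 * Linf_norm P (\<lambda>\<omega>. F (\<eta> \<omega>))) powr \<alpha>_exponent P (\<lambda>\<omega>. F (\<eta> \<omega>)))
      * (\<integral>\<^sup>+x. ennreal (\<Psi> (prob_space.expectation P (\<lambda>\<omega>. \<bar>add_one_cost x F (\<eta> \<omega>)\<bar>))) \<partial>M)"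
proof -
  interpret P: prob_space P by fact
  let ?X = "\<lambda>\<omega>. F (\<eta> \<omega>)"
  let ?c = "Linf_norm P ?X"
  let ?I = "\<integral>\<^sup>+x. ennreal (P.expectation (\<lambda>\<omega>. \<bar>add_one_cost x F (\<eta> \<omega>)\<bar>)) \<partial>M"
  have "\<eta> \<in> P \<rightarrow>\<^sub>M point_measure_space M"
    using assms(3) by (simp add: poisson_process_def)
  then have X: "?X \<in> borel_measurable P"
    using assms(4) by (rule measurable_compose)
  obtain C where "AE \<omega> in P. \<bar>?X \<omega>\<bar> \<le> C"
    using assms(5) by blast
  note c = Linf_norm_AE_bound[OF assms(1) X this]
  have "ennreal (P.variance ?X) \<le> ennreal (4 * ?c) * ?I"
    using assms(6)
  proof
    assume "\<forall>x\<in>space M. \<forall>y\<in>space M.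
      (AE \<omega> in P. add_one_cost x F (\<eta> \<omega>) \<ge> 0) \<and>
      (AE \<omega> in P. add_one_cost x (add_one_cost y F) (\<eta> \<omega>) \<le> 0)"
    then show ?thesis
      by (intro poisson_variance_le[OF assms(1-4) c]) blast+
  next
    assume *: "\<forall>x\<in>space M. \<forall>y\<in>space M.
      (AE \<omega> in P. add_one_cost x F (\<eta> \<omega>) \<le> 0) \<and>
      (AE \<omega> in P. add_one_cost x (add_one_cost y F) (\<eta> \<omega>) \<ge> 0)"
    \<comment> \<open>The second case is the first one for \<open>- F\<close>: negation commutes
      with add-one costs and changes neither the variance nor the absolute add-one costs.\<close>
    have neg: "add_one_cost x (\<lambda>\<mu>. - G \<mu>) = (\<lambda>\<mu>. - add_one_cost x G \<mu>)" for x and G :: "'a measure \<Rightarrow> real"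
      by (simp add: add_one_cost_def fun_eq_iff)
    have "ennreal (P.variance (\<lambda>\<omega>. - F (\<eta> \<omega>)))
        \<le> ennreal (4 * ?c) * (\<integral>\<^sup>+x. ennreal (P.expectation (\<lambda>\<omega>. \<bar>add_one_cost x (\<lambda>\<mu>. - F \<mu>) (\<eta> \<omega>)\<bar>)) \<partial>M)"
    proof (rule poisson_variance_le[OF assms(1-3) _ _ c(2)])
      show "(\<lambda>\<mu>. - F \<mu>) \<in> borel_measurable (point_measure_space M)"
        using assms(4) by simp
      show "AE \<omega> in P. \<bar>- F (\<eta> \<omega>)\<bar> \<le> ?c"
        using c(1) by simp
    qed (use * in \<open>simp_all add: neg\<close>)
    moreover have "P.variance (\<lambda>\<omega>. - F (\<eta> \<omega>)) = P.variance ?X"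
      by (simp add: power2_commute)
    ultimately show ?thesis
      by (simp add: neg)
  qed
  also have "\<dots> \<le> ennreal (11 * (2 * ?c) powr \<alpha>_exponent P ?X) *
      (\<integral>\<^sup>+x. ennreal (\<Psi> (P.expectation (\<lambda>\<omega>. \<bar>add_one_cost x F (\<eta> \<omega>)\<bar>))) \<partial>M)"
  proof (rule mult_mono[OF ennreal_leI nn_integral_mono[OF ennreal_leI]])
    \<comment> \<open>Write \<open>4 * ?c\<close> as twice \<open>2 * ?c\<close>; the latter is at
      most its power, and \<open>2 \<le> 11\<close>.\<close>
    show "4 * ?c \<le> 11 * (2 * ?c) powr \<alpha>_exponent P ?X"
      using le_powr_\<alpha>_exponent[OF c(2)] c(2) by linarith
    show "P.expectation (\<lambda>\<omega>. \<bar>add_one_cost x F (\<eta> \<omega>)\<bar>)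
        \<le> \<Psi> (P.expectation (\<lambda>\<omega>. \<bar>add_one_cost x F (\<eta> \<omega>)\<bar>))" for x
      by (rule \<Psi>_ge_self) simp
  qed simp_all
  finally show ?thesis .
qed

end
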